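(* Let $\lambda\neq0$ be a real number and let $X=f_1e_1+f_2e_2+f_3e_3$ be a vector field on $(H_3,g_2)$, where $f_1,f_2,f_3$ are smooth real functions of $(x,y,z)\in\mathbb{R}^3$. Then $X$ is an affine vector field on $(H_3,g_2)$ if and only if there exist real constants $c_1,c_2,c_3,c_4$ such that $$\begin{cases} f_1(x,y,z)=c_1x+c_2,\\ f_2(x,y,z)=-\lambda c_1y+c_3,\\ f_3(x,y,z)=\frac{\lambda^2c_1}{2}y^2+\frac{c_1}{2}x^2+c_2x-\lambda c_3y+c_4.\end{cases}$$
   Context: The Heisenberg group $H_3$ is $\mathbb{R}^3$ with global coordinates $(x,y,z)$ and multiplication $(x,y,z)(\tilde x,\tilde y,\tilde z)=(x+\tilde x,y+\tilde y,z+\tilde z-x\tilde y)$. For $\lambda\neq0$, $g_2$ is the left-invariant Lorentzian metric $g_2=\frac{1}{\lambda^2}dx^2+dy^2-(x\,dy+dz)^2$, with left-invariant orthonormal frame $e_1=\partial_y-x\partial_z$, $e_2=\lambda\partial_x$, $e_3=\partial_z$ ($e_3$ timelike). A smooth vector field $X$ on a pseudo-Riemannian manifold $(M,g)$ with Levi-Civita connection $\nabla$ is affine if $\mathcal{L}_X\nabla=0$, i.e. $[X,\nabla_YZ]=\nabla_{[X,Y]}Z+\nabla_Y[X,Z]$ for all vector fields $Y,Z$. *)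

theory Defs
  imports "HOL-Analysis.Analysis"
begin

text \<open>
  Differential geometry on a single global chart: the manifold is the whole Euclidean space
  \<^typ>\<open>'a\<close>, tangent spaces are identified with \<^typ>\<open>'a\<close> through the coordinate frame, and a vector
  field is the map sending a point to its coordinate components there.
\<close>

text \<open>Class \<open>C\<^sup>k\<close>, by continuity of all iterated directional derivatives (equivalent to the
  usual definition because the domain has finite dimension).\<close>

primrec C_k :: "nat \<Rightarrow> ('a::euclidean_space \<Rightarrow> 'b::real_normed_vector) \<Rightarrow> bool" where
  "C_k 0 f \<longleftrightarrow> continuous_on UNIV f"
| "C_k (Suc k) f \<longleftrightarrow>
     f differentiable_on UNIV \<and> (\<forall>v. C_k k (\<lambda>p. frechet_derivative f (at p) v))"

definition smooth :: "('a::euclidean_space \<Rightarrow> 'b::real_normed_vector) \<Rightarrow> bool" where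
  "smooth f \<longleftrightarrow> (\<forall>k. C_k k f)"

definition dir_deriv ::
    "('a::euclidean_space \<Rightarrow> 'a) \<Rightarrow> ('a \<Rightarrow> 'b::real_normed_vector) \<Rightarrow> 'a \<Rightarrow> 'b" where
  "dir_deriv X f p = frechet_derivative f (at p) (X p)"

text \<open>The convention is \<open>[X, Y] f = X (Y f) - Y (X f)\<close>, which in coordinates reads as follows.\<close>

definition lie_bracket ::
    "('a::euclidean_space \<Rightarrow> 'a) \<Rightarrow> ('a \<Rightarrow> 'a) \<Rightarrow> 'a \<Rightarrow> 'a" where
  "lie_bracket X Y p = dir_deriv X Y p - dir_deriv Y X p"

definition affine_connection ::
    "(('a::euclidean_space \<Rightarrow> 'a) \<Rightarrow> ('a \<Rightarrow> 'a) \<Rightarrow> 'a \<Rightarrow> 'a) \<Rightarrow> bool" where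
  "affine_connection D \<longleftrightarrow>
    (\<forall>Y Z. smooth Y \<longrightarrow> smooth Z \<longrightarrow> smooth (D Y Z)) \<and>
    (\<forall>Y Y' Z. smooth Y \<longrightarrow> smooth Y' \<longrightarrow> smooth Z \<longrightarrow>
        D (\<lambda>p. Y p + Y' p) Z = (\<lambda>p. D Y Z p + D Y' Z p)) \<and>
    (\<forall>(h :: 'a \<Rightarrow> real) Y Z. smooth h \<longrightarrow> smooth Y \<longrightarrow> smooth Z \<longrightarrow>
        D (\<lambda>p. h p *\<^sub>R Y p) Z = (\<lambda>p. h p *\<^sub>R D Y Z p)) \<and>
    (\<forall>Y Z Z'. smooth Y \<longrightarrow> smooth Z \<longrightarrow> smooth Z' \<longrightarrow>
        D Y (\<lambda>p. Z p + Z' p) = (\<lambda>p. D Y Z p + D Y Z' p)) \<and>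
    (\<forall>(h :: 'a \<Rightarrow> real) Y Z. smooth h \<longrightarrow> smooth Y \<longrightarrow> smooth Z \<longrightarrow>
        D Y (\<lambda>p. h p *\<^sub>R Z p) = (\<lambda>p. dir_deriv Y h p *\<^sub>R Z p + h p *\<^sub>R D Y Z p))"

definition torsion_free ::
    "(('a::euclidean_space \<Rightarrow> 'a) \<Rightarrow> ('a \<Rightarrow> 'a) \<Rightarrow> 'a \<Rightarrow> 'a) \<Rightarrow> bool" where
  "torsion_free D \<longleftrightarrow>
    (\<forall>Y Z. smooth Y \<longrightarrow> smooth Z \<longrightarrow> (\<lambda>p. D Y Z p - D Z Y p) = lie_bracket Y Z)"

definition metric_compatible ::
    "('a::euclidean_space \<Rightarrow> 'a \<Rightarrow> 'a \<Rightarrow> real)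
      \<Rightarrow> (('a \<Rightarrow> 'a) \<Rightarrow> ('a \<Rightarrow> 'a) \<Rightarrow> 'a \<Rightarrow> 'a) \<Rightarrow> bool" where
  "metric_compatible g D \<longleftrightarrow>
    (\<forall>Y Z W. smooth Y \<longrightarrow> smooth Z \<longrightarrow> smooth W \<longrightarrow>
        dir_deriv Y (\<lambda>p. g p (Z p) (W p)) =
        (\<lambda>p. g p (D Y Z p) (W p) + g p (Z p) (D Y W p)))"

text \<open>For a smooth non-degenerate symmetric \<open>g\<close> the three conditions determine the connection on
  smooth vector fields. Its values on other arguments are left open, and the definition of
  affine vector fields never refers to them.\<close>

definition levi_civita ::
    "('a::euclidean_space \<Rightarrow> 'a \<Rightarrow> 'a \<Rightarrow> real)
      \<Rightarrow> ('a \<Rightarrow> 'a) \<Rightarrow> ('a \<Rightarrow> 'a) \<Rightarrow> 'a \<Rightarrow> 'a" where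
  "levi_civita g = (SOME D. affine_connection D \<and> torsion_free D \<and> metric_compatible g D)"

definition affine_vector_field ::
    "('a::euclidean_space \<Rightarrow> 'a \<Rightarrow> 'a \<Rightarrow> real) \<Rightarrow> ('a \<Rightarrow> 'a) \<Rightarrow> bool" where
  "affine_vector_field g X \<longleftrightarrow> smooth X \<and>
    (\<forall>Y Z. smooth Y \<longrightarrow> smooth Z \<longrightarrow>
      lie_bracket X (levi_civita g Y Z) =
      (\<lambda>p. levi_civita g (lie_bracket X Y) Z p + levi_civita g Y (lie_bracket X Z) p))"

text \<open>The Heisenberg group: a point \<open>p\<close> has coordinates \<open>x = p $ 1\<close>, \<open>y = p $ 2\<close>, \<open>z = p $ 3\<close>.\<close>

definition heis_mult :: "real ^ 3 \<Rightarrow> real ^ 3 \<Rightarrow> real ^ 3" where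
  "heis_mult p q = vector [p $ 1 + q $ 1, p $ 2 + q $ 2, p $ 3 + q $ 3 - p $ 1 * q $ 2]"

text \<open>The metric \<open>dx\<^sup>2 / \<lambda>\<^sup>2 + dy\<^sup>2 - (x dy + dz)\<^sup>2\<close>, polarised.\<close>

definition heis_g2 :: "real \<Rightarrow> real ^ 3 \<Rightarrow> real ^ 3 \<Rightarrow> real ^ 3 \<Rightarrow> real" where
  "heis_g2 lam p v w =
     1 / lam\<^sup>2 * (v $ 1 * w $ 1) + v $ 2 * w $ 2
     - (p $ 1 * v $ 2 + v $ 3) * (p $ 1 * w $ 2 + w $ 3)"

definition heis_e1 :: "real ^ 3 \<Rightarrow> real ^ 3" where
  "heis_e1 p = vector [0, 1, - (p $ 1)]"

definition heis_e2 :: "real \<Rightarrow> real ^ 3 \<Rightarrow> real ^ 3" where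
  "heis_e2 lam p = vector [lam, 0, 0]"

definition heis_e3 :: "real ^ 3 \<Rightarrow> real ^ 3" where
  "heis_e3 p = vector [0, 0, 1]"

lemma heis_frame_orthonormal:
  assumes "lam \<noteq> 0"
  shows "heis_g2 lam p (heis_e1 p) (heis_e1 p) = 1"
    "heis_g2 lam p (heis_e2 lam p) (heis_e2 lam p) = 1"
    "heis_g2 lam p (heis_e3 p) (heis_e3 p) = -1"
    "heis_g2 lam p (heis_e1 p) (heis_e2 lam p) = 0"
    "heis_g2 lam p (heis_e1 p) (heis_e3 p) = 0"
    "heis_g2 lam p (heis_e2 lam p) (heis_e3 p) = 0"
  using assms
  by (simp_all add: heis_g2_def heis_e1_def heis_e2_def heis_e3_def power2_eq_square)

lemma heis_left_translation_has_derivative: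
  "(heis_mult a has_derivative (\<lambda>v. vector [v $ 1, v $ 2, v $ 3 - a $ 1 * v $ 2])) (at p)"
proof -
  have lin: "bounded_linear (\<lambda>v :: real ^ 3. vector [v $ 1, v $ 2, v $ 3 - a $ 1 * v $ 2] :: real ^ 3)"
    by (intro linear_conv_bounded_linear[THEN iffD1] linearI)
       (simp_all add: vec_eq_iff forall_3 algebra_simps)
  have "heis_mult a = (\<lambda>v. a + vector [v $ 1, v $ 2, v $ 3 - a $ 1 * v $ 2])"
    by (simp add: fun_eq_iff heis_mult_def vec_eq_iff forall_3)
  then show ?thesis
    using has_derivative_add[OF has_derivative_const bounded_linear_imp_has_derivative[OF lin]]
    by simp
qed

lemma heis_frame_left_invariant:
  "frechet_derivative (heis_mult a) (at p) (heis_e1 p) = heis_e1 (heis_mult a p)"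
  "frechet_derivative (heis_mult a) (at p) (heis_e2 lam p) = heis_e2 lam (heis_mult a p)"
  "frechet_derivative (heis_mult a) (at p) (heis_e3 p) = heis_e3 (heis_mult a p)"
  unfolding frechet_derivative_at[OF heis_left_translation_has_derivative, symmetric]
  by (simp_all add: heis_mult_def heis_e1_def heis_e2_def heis_e3_def vec_eq_iff forall_3)

lemma heis_g2_left_invariant:
  "heis_g2 lam (heis_mult a p) (frechet_derivative (heis_mult a) (at p) v)
     (frechet_derivative (heis_mult a) (at p) w) = heis_g2 lam p v w"
  unfolding frechet_derivative_at[OF heis_left_translation_has_derivative, symmetric]
  by (simp add: heis_mult_def heis_g2_def algebra_simps)

end

(*
  An affine field X preserves the Levi-Civita connection, hence also the curvature tensor:
  [X, R(Y,Z)W] = R([X,Y],Z)W + R(Y,[X,Z])W + R(Y,Z)[X,W]. On the left-invariant frame R has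
  constant coefficients, of size lam^2/4 for the planes containing the timelike direction e3 but
  3 lam^2/4 for the plane e1, e2. Because of this difference, invariance of R already forces
  all the Killing equations, a first-order system for f1, f2, f3 with a four-parameter solution
  space. Conversely, the Lie derivative of the connection is a tensor, so for the listed fields
  it only has to be seen to vanish on the frame, where everything is constant.
*)

theory Submission
  imports Defs
begin

text \<open>Written out, the affine condition is a coupled system of second order in
  \<open>f1\<close>, \<open>f2\<close>, \<open>f3\<close>. Passing to the curvature lowers the
  order: on the frame, invariance of R is at each point a system of linear equations in the nine
  frame coefficients of [X, e1], [X, e2], [X, e3], and these contain only first derivatives. The
  factor 3 comes from [e1, e2] = lam e3: in R(e1, e2) the term with D along [e1, e2] is twice the
  iterated derivatives and has the same sign, while for the other two planes the bracket vanishes.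
  The result is slightly stronger than the Killing equations, which would only tie [X, e3] to the
  e3-parts of [X, e1] and [X, e2]; here all of these vanish. So X can only rotate the plane of e1
  and e2, at a rate that turns out to be constant, namely lam c1; the other three constants come
  from integration. Since \<open>levi_civita\<close> is a choice, it can be computed only after a
  connection with the required properties has been exhibited and uniqueness on smooth fields has
  been proved.\<close>

subsection \<open>Calculus of smooth functions\<close>

lemma C_k_SucD: "C_k (Suc k) f \<Longrightarrow> C_k k f"
proof (induction k arbitrary: f)
  case 0
  then show ?case
    by (auto intro: differentiable_imp_continuous_on)
next
  case (Suc k)
  from Suc.prems have "f differentiable_on UNIV"
    and "\<And>v. C_k (Suc k) (\<lambda>p. frechet_derivative f (at p) v)"
    by (simp_all only: C_k.simps(2)[of "Suc k"])
  with Suc.IH show ?case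
    by simp
qed

text \<open>Removes the index k from later arguments. From right to left, the derivatives give all
  levels \<open>Suc k\<close>, and \<open>C_k_SucD\<close> descends to level 0.\<close>

lemma smooth_iff:
  "smooth f \<longleftrightarrow>
     f differentiable_on UNIV \<and> (\<forall>v. smooth (\<lambda>p. frechet_derivative f (at p) v))"
  unfolding smooth_def by (metis C_k.simps(2) C_k_SucD)

lemma smooth_has_derivative:
  assumes "smooth f"
  shows "(f has_derivative frechet_derivative f (at p)) (at p)"
  using smooth_iff[THEN iffD1, OF assms] by (simp add: differentiable_on_def frechet_derivative_works)

lemma smooth_continuous:
  assumes "smooth f"
  shows "continuous_on UNIV f"
  using smooth_iff[THEN iffD1, OF assms] by (simp add: differentiable_imp_continuous_on)

lemma C_k_const: "C_k k (\<lambda>p. c)"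
  by (induction k arbitrary: c) simp_all

lemma C_k_linear:
  assumes L: "bounded_linear L"
  shows "C_k k f \<Longrightarrow> C_k k (\<lambda>p. L (f p))"
proof (induction k arbitrary: f)
  case 0
  then show ?case
    using bounded_linear.continuous_on[OF L] by simp
next
  case (Suc k)
  have d: "((\<lambda>p. L (f p)) has_derivative (\<lambda>v. L (frechet_derivative f (at p) v))) (at p)" for p
    using Suc.prems
    by (intro bounded_linear.has_derivative[OF L])
       (simp add: differentiable_on_def frechet_derivative_works)
  have "(\<lambda>p. L (f p)) differentiable_on UNIV"
    using d by (auto simp: differentiable_on_def intro: differentiableI)
  then show ?case
    using Suc by (simp flip: frechet_derivative_at[OF d])
qed

lemma C_k_add:
  "C_k k f \<Longrightarrow> C_k k g \<Longrightarrow> C_k k (\<lambda>p. f p + g p)"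
proof (induction k arbitrary: f g)
  case 0
  then show ?case
    by (auto intro: continuous_intros)
next
  case (Suc k)
  have d: "((\<lambda>p. f p + g p) has_derivative
      (\<lambda>v. frechet_derivative f (at p) v + frechet_derivative g (at p) v)) (at p)" for p
    using Suc.prems
    by (intro has_derivative_add) (simp_all add: differentiable_on_def frechet_derivative_works)
  have "(\<lambda>p. f p + g p) differentiable_on UNIV"
    using d by (auto simp: differentiable_on_def intro: differentiableI)
  then show ?case
    using Suc by (simp flip: frechet_derivative_at[OF d])
qed

text \<open>One product rule that covers scalar multiples, real products and inner products.\<close>

lemma C_k_bilinear:
  assumes B: "bounded_bilinear B"
  shows "C_k k f \<Longrightarrow> C_k k g \<Longrightarrow> C_k k (\<lambda>p. B (f p) (g p))"
proof (induction k arbitrary: f g)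
  case 0
  then show ?case
    using bounded_bilinear.continuous_on[OF B] by simp
next
  case (Suc k)
  have d: "((\<lambda>p. B (f p) (g p)) has_derivative
      (\<lambda>v. B (f p) (frechet_derivative g (at p) v) + B (frechet_derivative f (at p) v) (g p)))
      (at p)" for p
    using Suc.prems
    by (intro bounded_bilinear.FDERIV[OF B])
       (simp_all add: differentiable_on_def frechet_derivative_works)
  have "(\<lambda>p. B (f p) (g p)) differentiable_on UNIV"
    using d by (auto simp: differentiable_on_def intro: differentiableI)
  \<comment> \<open>The product rule pairs a derivative with an undifferentiated factor, so the
    induction hypothesis also needs the factors themselves at the lower level.\<close>
  moreover have "C_k k f" "C_k k g"
    using Suc.prems by (auto dest: C_k_SucD simp del: C_k.simps)
  ultimately show ?case
    using Suc by (simp add: C_k_add flip: frechet_derivative_at[OF d])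
qed

named_theorems smooth_intros

lemma smooth_const [smooth_intros]: "smooth (\<lambda>p. c)"
  by (simp add: smooth_def C_k_const)

lemma smooth_linear: "bounded_linear L \<Longrightarrow> smooth f \<Longrightarrow> smooth (\<lambda>p. L (f p))"
  by (simp add: smooth_def C_k_linear)

lemma smooth_bilinear:
  "bounded_bilinear B \<Longrightarrow> smooth f \<Longrightarrow> smooth g \<Longrightarrow> smooth (\<lambda>p. B (f p) (g p))"
  by (simp add: smooth_def C_k_bilinear)

lemma smooth_ident [smooth_intros]: "smooth (\<lambda>p. p)"
  by (subst smooth_iff) (auto simp: smooth_const differentiable_on_def)

lemma smooth_add [smooth_intros]: "smooth f \<Longrightarrow> smooth g \<Longrightarrow> smooth (\<lambda>p. f p + g p)"
  by (simp add: smooth_def C_k_add)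

lemmas smooth_minus [smooth_intros] =
  smooth_linear[OF bounded_linear_minus[OF bounded_linear_ident]]

lemma smooth_diff [smooth_intros]: "smooth f \<Longrightarrow> smooth g \<Longrightarrow> smooth (\<lambda>p. f p - g p)"
  using smooth_add[of f "\<lambda>p. - g p"] by (simp add: smooth_minus)

lemmas smooth_scaleR [smooth_intros] = smooth_bilinear[OF bounded_bilinear_scaleR]

lemma smooth_mult [smooth_intros]:
  "smooth f \<Longrightarrow> smooth g \<Longrightarrow> smooth (\<lambda>p. f p * g p :: real)"
  by (rule smooth_bilinear[OF bounded_bilinear_mult])

lemma smooth_power [smooth_intros]: "smooth f \<Longrightarrow> smooth (\<lambda>p. f p ^ n :: real)"
  by (induction n) (auto intro: smooth_intros)

lemma smooth_divide_const [smooth_intros]: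
  "smooth f \<Longrightarrow> smooth (\<lambda>p. f p / c :: real)"
  by (rule smooth_linear[OF bounded_linear_divide])

lemma smooth_inner [smooth_intros]:
  "smooth f \<Longrightarrow> smooth g \<Longrightarrow> smooth (\<lambda>p. f p \<bullet> g p)"
  by (rule smooth_bilinear[OF bounded_bilinear_inner])

lemmas smooth_nth [smooth_intros] = smooth_linear[OF bounded_linear_vec_nth]

lemma smooth_sum [smooth_intros]:
  "(\<And>i. i \<in> I \<Longrightarrow> smooth (f i)) \<Longrightarrow> smooth (\<lambda>p. \<Sum>i\<in>I. f i p)"
  by (induction I rule: infinite_finite_induct) (auto intro: smooth_intros)

lemma vector_3_eq:
  "(vector [a, b, c] :: real ^ 3) =
     a *\<^sub>R vector [1, 0, 0] + b *\<^sub>R vector [0, 1, 0] + c *\<^sub>R vector [0, 0, 1]"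
  by (simp add: vec_eq_iff forall_3)

lemma smooth_vector_3 [smooth_intros]:
  assumes "smooth a" "smooth b" "smooth c"
  shows "smooth (\<lambda>p. vector [a p, b p, c p] :: real ^ 3)"
  by (subst vector_3_eq) (intro smooth_intros assms)

section \<open>Rules for directional derivatives along vector fields\<close>

lemma dir_deriv_eqI:
  "(f has_derivative f') (at p) \<Longrightarrow> dir_deriv X f p = f' (X p)"
  by (simp add: dir_deriv_def flip: frechet_derivative_at)

lemma dir_deriv_const: "dir_deriv X (\<lambda>p. c) p = 0"
  by (simp add: dir_deriv_def)

lemma dir_deriv_ident: "dir_deriv X (\<lambda>p. p) p = X p"
  by (simp add: dir_deriv_def)

lemma dir_deriv_linear:
  "bounded_linear L \<Longrightarrow> smooth f \<Longrightarrow> dir_deriv X (\<lambda>p. L (f p)) p = L (dir_deriv X f p)"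
  unfolding dir_deriv_def[of X f]
  by (rule dir_deriv_eqI[OF bounded_linear.has_derivative[OF _ smooth_has_derivative]])

lemma dir_deriv_bilinear:
  "bounded_bilinear B \<Longrightarrow> smooth f \<Longrightarrow> smooth g \<Longrightarrow>
     dir_deriv X (\<lambda>p. B (f p) (g p)) p = B (f p) (dir_deriv X g p) + B (dir_deriv X f p) (g p)"
  unfolding dir_deriv_def[of X f] dir_deriv_def[of X g]
  by (rule dir_deriv_eqI[OF bounded_bilinear.FDERIV[OF _ smooth_has_derivative smooth_has_derivative]])

lemma dir_deriv_add:
  "smooth f \<Longrightarrow> smooth g \<Longrightarrow>
     dir_deriv X (\<lambda>p. f p + g p) p = dir_deriv X f p + dir_deriv X g p"
  unfolding dir_deriv_def[of X f] dir_deriv_def[of X g]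
  by (rule dir_deriv_eqI[OF has_derivative_add[OF smooth_has_derivative smooth_has_derivative]])

lemma dir_deriv_diff:
  "smooth f \<Longrightarrow> smooth g \<Longrightarrow>
     dir_deriv X (\<lambda>p. f p - g p) p = dir_deriv X f p - dir_deriv X g p"
  unfolding dir_deriv_def[of X f] dir_deriv_def[of X g]
  by (rule dir_deriv_eqI[OF has_derivative_diff[OF smooth_has_derivative smooth_has_derivative]])

lemma dir_deriv_minus: "smooth f \<Longrightarrow> dir_deriv X (\<lambda>p. - f p) p = - dir_deriv X f p"
  by (rule dir_deriv_linear[OF bounded_linear_minus[OF bounded_linear_ident]])

lemmas dir_deriv_scaleR = dir_deriv_bilinear[OF bounded_bilinear_scaleR]

lemma dir_deriv_mult:
  "smooth f \<Longrightarrow> smooth g \<Longrightarrow>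
     dir_deriv X (\<lambda>p. f p * g p :: real) p = f p * dir_deriv X g p + dir_deriv X f p * g p"
  by (rule dir_deriv_bilinear[OF bounded_bilinear_mult])

lemma dir_deriv_divide_const:
  "smooth f \<Longrightarrow> dir_deriv X (\<lambda>p. f p / c :: real) p = dir_deriv X f p / c"
  by (rule dir_deriv_linear[OF bounded_linear_divide])

lemmas dir_deriv_nth = dir_deriv_linear[OF bounded_linear_vec_nth]

lemma dir_deriv_nth_ident: "dir_deriv X (\<lambda>p. p $ i) p = X p $ i"
  using dir_deriv_nth[OF smooth_ident, of X i p] by (simp add: dir_deriv_ident)

lemma dir_deriv_sum:
  "(\<And>i. i \<in> I \<Longrightarrow> smooth (f i)) \<Longrightarrow>
     dir_deriv X (\<lambda>p. \<Sum>i\<in>I. f i p) p = (\<Sum>i\<in>I. dir_deriv X (f i) p)"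
  by (induction I rule: infinite_finite_induct)
     (simp_all add: dir_deriv_const dir_deriv_add smooth_sum)

lemma dir_deriv_vector_3:
  assumes "smooth a" "smooth b" "smooth c"
  shows "dir_deriv X (\<lambda>p. vector [a p, b p, c p] :: real ^ 3) p =
    vector [dir_deriv X a p, dir_deriv X b p, dir_deriv X c p]"
proof -
  have *: "smooth (\<lambda>p. vector [a p, b p, c p] :: real ^ 3)"
    by (intro smooth_intros assms)
  show ?thesis
    by (simp add: vec_eq_iff forall_3 flip: dir_deriv_nth[OF *])
qed

lemma dir_deriv_add_field:
  "smooth f \<Longrightarrow> dir_deriv (\<lambda>p. X p + Y p) f p = dir_deriv X f p + dir_deriv Y f p"
  unfolding dir_deriv_def by (rule linear_add[OF has_derivative_linear[OF smooth_has_derivative]])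

lemma dir_deriv_diff_field:
  "smooth f \<Longrightarrow> dir_deriv (\<lambda>p. X p - Y p) f p = dir_deriv X f p - dir_deriv Y f p"
  unfolding dir_deriv_def by (rule linear_diff[OF has_derivative_linear[OF smooth_has_derivative]])

lemma dir_deriv_scaleR_field:
  "smooth f \<Longrightarrow> dir_deriv (\<lambda>p. h p *\<^sub>R X p) f p = h p *\<^sub>R dir_deriv X f p"
  unfolding dir_deriv_def by (rule linear_scale[OF has_derivative_linear[OF smooth_has_derivative]])

lemmas dir_deriv_simps = dir_deriv_const dir_deriv_ident dir_deriv_nth_ident dir_deriv_add
  dir_deriv_diff dir_deriv_minus dir_deriv_scaleR dir_deriv_mult dir_deriv_divide_const dir_deriv_nth
  dir_deriv_vector_3
  dir_deriv_add_field dir_deriv_diff_field dir_deriv_scaleR_field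

lemma smooth_frechet_derivative [smooth_intros]:
  "smooth f \<Longrightarrow> smooth (\<lambda>p. frechet_derivative f (at p) v)"
  using smooth_iff[THEN iffD1, of f] by blast

lemma frechet_derivative_basis_sum:
  assumes "smooth f"
  shows "frechet_derivative f (at p) v = (\<Sum>b\<in>Basis. (v \<bullet> b) *\<^sub>R frechet_derivative f (at p) b)"
proof -
  interpret linear "frechet_derivative f (at p)"
    by (rule has_derivative_linear[OF smooth_has_derivative[OF assms]])
  show ?thesis
    by (subst (1) euclidean_representation[of v, symmetric]) (simp only: sum scale)
qed

text \<open>Smoothness of derivatives is known only for a fixed direction, whereas here the
  direction \<open>X p\<close> varies. The expansion separates the two dependences on
  \<open>p\<close> into products of smooth functions.\<close>

lemma dir_deriv_basis_sum:
  assumes "smooth f"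
  shows "dir_deriv X f = (\<lambda>p. \<Sum>b\<in>Basis. (X p \<bullet> b) *\<^sub>R frechet_derivative f (at p) b)"
  unfolding dir_deriv_def using frechet_derivative_basis_sum[OF assms] by blast

lemma smooth_dir_deriv [smooth_intros]:
  assumes "smooth X" "smooth f"
  shows "smooth (dir_deriv X f)"
  unfolding dir_deriv_basis_sum[OF assms(2)] by (intro smooth_intros assms)

section \<open>Symmetry of second derivatives\<close>

text \<open>The left-hand side is symmetric in \<open>u\<close> and \<open>v\<close>, which gives Schwarz's theorem as \<open>t\<close>
  tends to 0.\<close>

lemma mixed_difference_mean_value:
  fixes f :: "'a::euclidean_space \<Rightarrow> real"
  assumes f: "smooth f" and t: "0 < t"
  obtains r s where "0 < r" "r < t" "0 < s" "s < t"
    "f (p + t *\<^sub>R u + t *\<^sub>R v) - f (p + t *\<^sub>R u) - f (p + t *\<^sub>R v) + f p =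
       t * (t * frechet_derivative (\<lambda>q. frechet_derivative f (at q) u)
         (at (p + r *\<^sub>R u + s *\<^sub>R v)) v)"
proof -
  have line: "((\<lambda>s. g (q + s *\<^sub>R w)) has_real_derivative frechet_derivative g (at (q + s *\<^sub>R w)) w) (at s)"
    if g: "smooth g" for g :: "'a \<Rightarrow> real" and q w s
  proof -
    have l: "linear (frechet_derivative g (at (q + s *\<^sub>R w)))"
      by (rule has_derivative_linear[OF smooth_has_derivative[OF g]])
    have "((\<lambda>s. g (q + s *\<^sub>R w)) has_derivative
        (\<lambda>h. frechet_derivative g (at (q + s *\<^sub>R w)) (h *\<^sub>R w))) (at s)"
      by (rule has_derivative_compose[OF _ smooth_has_derivative[OF g]])
         (auto intro!: derivative_eq_intros)
    then show ?thesis
      by (simp add: has_field_derivative_def linear_scale[OF l] mult.commute[of _ "frechet_derivative _ _ _"]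
          fun_eq_iff[THEN iffD2])
  qed
  define g where "g q = frechet_derivative f (at q) u" for q
  have g: "smooth g"
    unfolding g_def by (intro smooth_intros f)
  \<comment> \<open>The double difference is an increment in direction \<open>u\<close> of the
    difference in direction \<open>v\<close>. One mean value step replaces \<open>f\<close> by its
    derivative along \<open>u\<close>, and a second one is then taken along
    \<open>v\<close>.\<close>
  have "((\<lambda>r. f ((p + t *\<^sub>R v) + r *\<^sub>R u) - f (p + r *\<^sub>R u)) has_real_derivative
      g ((p + t *\<^sub>R v) + r *\<^sub>R u) - g (p + r *\<^sub>R u)) (at r)" for r
    unfolding g_def by (intro DERIV_diff line f)
  from MVT2[OF t this] obtain r where r: "0 < r" "r < t"
    "(f ((p + t *\<^sub>R v) + t *\<^sub>R u) - f (p + t *\<^sub>R u)) - (f (p + t *\<^sub>R v) - f p) =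
       t * (g ((p + t *\<^sub>R v) + r *\<^sub>R u) - g (p + r *\<^sub>R u))"
    by auto
  from MVT2[OF t line[OF g, of "p + r *\<^sub>R u" v]] obtain s where s: "0 < s" "s < t"
    "g ((p + r *\<^sub>R u) + t *\<^sub>R v) - g (p + r *\<^sub>R u) =
       t * frechet_derivative g (at (p + r *\<^sub>R u + s *\<^sub>R v)) v"
    by auto
  show thesis
    using r s by (intro that[of r s]) (simp_all add: g_def[abs_def] algebra_simps)
qed

lemma second_derivative_symmetric_real:
  fixes f :: "'a::euclidean_space \<Rightarrow> real"
  assumes f: "smooth f"
  shows "frechet_derivative (\<lambda>q. frechet_derivative f (at q) u) (at p) v =
    frechet_derivative (\<lambda>q. frechet_derivative f (at q) v) (at p) u"
proof -
  define H where "H u v q = frechet_derivative (\<lambda>q. frechet_derivative f (at q) u) (at q) v" for u v q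
  have near: "\<exists>d>0. \<forall>r s. 0 < r \<and> r < d \<and> 0 < s \<and> s < d \<longrightarrow>
      \<bar>H a b (p + r *\<^sub>R a + s *\<^sub>R b) - H a b p\<bar> < e" if e: "0 < e" for e a b
  proof -
    have "continuous_on UNIV (H a b)"
      unfolding H_def by (intro smooth_continuous smooth_intros f)
    then obtain d where d: "0 < d" "\<And>q. dist q p < d \<Longrightarrow> dist (H a b q) (H a b p) < e"
      using e unfolding continuous_on_iff by (metis UNIV_I)
    \<comment> \<open>The summand 1 keeps the denominator positive when \<open>a\<close> and
      \<open>b\<close> both vanish, and it makes the final estimate strict.\<close>
    define c where "c = d / (norm a + norm b + 1)"
    have m: "norm a + norm b + 1 > 0"
      by (simp add: add_nonneg_pos)
    have c: "0 < c"
      using d(1) m by (simp add: c_def)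
    have "\<bar>H a b (p + r *\<^sub>R a + s *\<^sub>R b) - H a b p\<bar> < e"
      if rs: "0 < r" "r < c" "0 < s" "s < c" for r s
    proof -
      have "norm (r *\<^sub>R a + s *\<^sub>R b) \<le> r * norm a + s * norm b"
        using norm_triangle_ineq[of "r *\<^sub>R a" "s *\<^sub>R b"] rs by simp
      also have "\<dots> \<le> c * norm a + c * norm b"
        using rs by (intro add_mono mult_right_mono) auto
      also have "\<dots> < c * (norm a + norm b + 1)"
        using c by (simp add: algebra_simps)
      also have "\<dots> = d"
        using m by (simp add: c_def)
      finally show ?thesis
        using d(2)[of "p + r *\<^sub>R a + s *\<^sub>R b"] by (simp add: dist_norm add.assoc)
    qed
    with c show ?thesis
      by blast
  qed
  have "\<bar>H u v p - H v u p\<bar> \<le> e" if e: "0 < e" for e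
  proof -
    obtain d1 where d1: "d1 > 0" "\<And>r s. 0 < r \<and> r < d1 \<and> 0 < s \<and> s < d1 \<Longrightarrow>
        \<bar>H u v (p + r *\<^sub>R u + s *\<^sub>R v) - H u v p\<bar> < e / 2"
      using near[of "e / 2" u v] e by (meson half_gt_zero)
    obtain d2 where d2: "d2 > 0" "\<And>r s. 0 < r \<and> r < d2 \<and> 0 < s \<and> s < d2 \<Longrightarrow>
        \<bar>H v u (p + r *\<^sub>R v + s *\<^sub>R u) - H v u p\<bar> < e / 2"
      using near[of "e / 2" v u] e by (meson half_gt_zero)
    define t where "t = min d1 d2"
    have t: "0 < t" "t \<le> d1" "t \<le> d2"
      using d1(1) d2(1) by (simp_all add: t_def)
    obtain r s where rs: "0 < r" "r < t" "0 < s" "s < t"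
      "f (p + t *\<^sub>R u + t *\<^sub>R v) - f (p + t *\<^sub>R u) - f (p + t *\<^sub>R v) + f p =
         t * (t * H u v (p + r *\<^sub>R u + s *\<^sub>R v))"
      using mixed_difference_mean_value[OF f t(1), of p u v] unfolding H_def by metis
    obtain r' s' where rs': "0 < r'" "r' < t" "0 < s'" "s' < t"
      "f (p + t *\<^sub>R v + t *\<^sub>R u) - f (p + t *\<^sub>R v) - f (p + t *\<^sub>R u) + f p =
         t * (t * H v u (p + r' *\<^sub>R v + s' *\<^sub>R u))"
      using mixed_difference_mean_value[OF f t(1), of p v u] unfolding H_def by metis
    have swap: "p + t *\<^sub>R v + t *\<^sub>R u = p + t *\<^sub>R u + t *\<^sub>R v"
      by simp
    have "t * (t * H u v (p + r *\<^sub>R u + s *\<^sub>R v)) = t * (t * H v u (p + r' *\<^sub>R v + s' *\<^sub>R u))"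
      using rs(5) rs'(5)[unfolded swap] by linarith
    then have "H u v (p + r *\<^sub>R u + s *\<^sub>R v) = H v u (p + r' *\<^sub>R v + s' *\<^sub>R u)"
      using t(1) by simp
    moreover have "\<bar>H u v (p + r *\<^sub>R u + s *\<^sub>R v) - H u v p\<bar> < e / 2"
      using rs t by (intro d1(2)) auto
    moreover have "\<bar>H v u (p + r' *\<^sub>R v + s' *\<^sub>R u) - H v u p\<bar> < e / 2"
      using rs' t by (intro d2(2)) auto
    ultimately show ?thesis
      by linarith
  qed
  then have "\<bar>H u v p - H v u p\<bar> \<le> 0"
    by (rule field_le_epsilon[of _ 0, simplified])
  then show ?thesis
    by (simp add: H_def)
qed

lemma second_derivative_symmetric:
  fixes f :: "'a::euclidean_space \<Rightarrow> 'b::euclidean_space"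
  assumes f: "smooth f"
  shows "frechet_derivative (\<lambda>q. frechet_derivative f (at q) u) (at p) v =
    frechet_derivative (\<lambda>q. frechet_derivative f (at q) v) (at p) u"
proof (rule euclidean_eqI)
  fix b :: 'b
  have inner: "frechet_derivative (\<lambda>q. g q \<bullet> b) (at q) w = frechet_derivative g (at q) w \<bullet> b"
    if "smooth g" for g :: "'a \<Rightarrow> 'b" and q w
    using dir_deriv_linear[OF bounded_linear_inner_left that, of "\<lambda>_. w" b q] by (simp add: dir_deriv_def)
  have "smooth (\<lambda>q. f q \<bullet> b)"
    by (intro smooth_intros f)
  from second_derivative_symmetric_real[OF this, of u p v]
  show "frechet_derivative (\<lambda>q. frechet_derivative f (at q) u) (at p) v \<bullet> b =
      frechet_derivative (\<lambda>q. frechet_derivative f (at q) v) (at p) u \<bullet> b"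
    by (simp add: inner f smooth_frechet_derivative)
qed

subsection \<open>Lie brackets\<close>

text \<open>The outer derivative hits either the field \<open>Y\<close> or the derivative of
  \<open>f\<close>. The second term is the Hessian of \<open>f\<close>, whose symmetry makes it
  cancel in a commutator.\<close>

lemma dir_deriv_dir_deriv:
  assumes f: "smooth f" and Y: "smooth Y"
  shows "dir_deriv X (dir_deriv Y f) p =
    frechet_derivative f (at p) (dir_deriv X Y p) +
    frechet_derivative (\<lambda>q. frechet_derivative f (at q) (Y p)) (at p) (X p)"
proof -
  have inner: "dir_deriv X (\<lambda>q. Y q \<bullet> b) p = dir_deriv X Y p \<bullet> b" for b
    by (rule dir_deriv_linear[OF bounded_linear_inner_left Y])
  have "dir_deriv X (dir_deriv Y f) p =
      (\<Sum>b\<in>Basis. dir_deriv X (\<lambda>q. (Y q \<bullet> b) *\<^sub>R frechet_derivative f (at q) b) p)"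
    unfolding dir_deriv_basis_sum[OF f, of Y] by (intro dir_deriv_sum smooth_intros f Y)
  also have "\<dots> = (\<Sum>b\<in>Basis. (Y p \<bullet> b) *\<^sub>R dir_deriv X (\<lambda>q. frechet_derivative f (at q) b) p) +
      (\<Sum>b\<in>Basis. (dir_deriv X Y p \<bullet> b) *\<^sub>R frechet_derivative f (at p) b)"
    by (simp add: dir_deriv_scaleR inner f Y smooth_intros sum.distrib)
  \<comment> \<open>The coefficients are frozen at \<open>p\<close>, so the sum is again the
    derivative of a single function, the derivative of \<open>f\<close> in the fixed direction
    \<open>Y p\<close>.\<close>
  also have "(\<Sum>b\<in>Basis. (Y p \<bullet> b) *\<^sub>R dir_deriv X (\<lambda>q. frechet_derivative f (at q) b) p) =
      (\<Sum>b\<in>Basis. dir_deriv X (\<lambda>q. (Y p \<bullet> b) *\<^sub>R frechet_derivative f (at q) b) p)"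
    by (simp add: dir_deriv_scaleR dir_deriv_const f smooth_intros)
  also have "\<dots> = dir_deriv X (\<lambda>q. \<Sum>b\<in>Basis. (Y p \<bullet> b) *\<^sub>R frechet_derivative f (at q) b) p"
    by (intro dir_deriv_sum[symmetric] smooth_intros f)
  also have "\<dots> = frechet_derivative (\<lambda>q. frechet_derivative f (at q) (Y p)) (at p) (X p)"
    by (simp add: dir_deriv_def flip: frechet_derivative_basis_sum[OF f])
  finally show ?thesis
    by (simp add: frechet_derivative_basis_sum[OF f, of p "dir_deriv X Y p"] add.commute)
qed

lemma smooth_lie_bracket [smooth_intros]:
  "smooth X \<Longrightarrow> smooth Y \<Longrightarrow> smooth (lie_bracket X Y)"
  unfolding lie_bracket_def by (intro smooth_intros)

text \<open>Links the coordinate formula for the bracket with commutators of derivations, by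
  cancelling the two Hessian terms. Vector-valued \<open>f\<close> is allowed because the Jacobi
  identity applies this to the fields themselves.\<close>

lemma dir_deriv_lie_bracket:
  fixes f :: "'a::euclidean_space \<Rightarrow> 'b::euclidean_space"
  assumes "smooth f" "smooth X" "smooth Y"
  shows "dir_deriv (lie_bracket X Y) f p =
    dir_deriv X (dir_deriv Y f) p - dir_deriv Y (dir_deriv X f) p"
  using second_derivative_symmetric[OF assms(1), of "Y p" p "X p"]
  by (simp add: dir_deriv_dir_deriv assms)
     (simp add: dir_deriv_def lie_bracket_def
        linear_diff[OF has_derivative_linear[OF smooth_has_derivative[OF assms(1)]]])

lemma lie_bracket_commute: "lie_bracket Y X p = - lie_bracket X Y p"
  by (simp add: lie_bracket_def)

lemma lie_bracket_add_right:
  "smooth X \<Longrightarrow> smooth Y \<Longrightarrow> smooth Z \<Longrightarrow>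
     lie_bracket X (\<lambda>p. Y p + Z p) p = lie_bracket X Y p + lie_bracket X Z p"
  by (simp add: lie_bracket_def dir_deriv_simps)

lemma lie_bracket_diff_right:
  "smooth X \<Longrightarrow> smooth Y \<Longrightarrow> smooth Z \<Longrightarrow>
     lie_bracket X (\<lambda>p. Y p - Z p) p = lie_bracket X Y p - lie_bracket X Z p"
  by (simp add: lie_bracket_def dir_deriv_simps)

lemma lie_bracket_scaleR_right:
  "smooth X \<Longrightarrow> smooth Y \<Longrightarrow> smooth h \<Longrightarrow>
     lie_bracket X (\<lambda>p. h p *\<^sub>R Y p) p = dir_deriv X h p *\<^sub>R Y p + h p *\<^sub>R lie_bracket X Y p"
  by (simp add: lie_bracket_def dir_deriv_simps algebra_simps)

lemma lie_bracket_add_left: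
  "smooth X \<Longrightarrow> smooth Y \<Longrightarrow> smooth Z \<Longrightarrow>
     lie_bracket (\<lambda>p. Y p + Z p) X p = lie_bracket Y X p + lie_bracket Z X p"
  by (simp add: lie_bracket_def dir_deriv_simps)

lemma lie_bracket_scaleR_left:
  "smooth X \<Longrightarrow> smooth Y \<Longrightarrow> smooth h \<Longrightarrow>
     lie_bracket (\<lambda>p. h p *\<^sub>R Y p) X p = h p *\<^sub>R lie_bracket Y X p - dir_deriv X h p *\<^sub>R Y p"
  by (simp add: lie_bracket_def dir_deriv_simps algebra_simps)

lemma lie_bracket_jacobi:
  assumes "smooth X" "smooth Y" "smooth Z"
  shows "lie_bracket X (lie_bracket Y Z) p =
    lie_bracket (lie_bracket X Y) Z p + lie_bracket Y (lie_bracket X Z) p"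
proof -
  have *: "dir_deriv U (lie_bracket V W) p = dir_deriv U (dir_deriv V W) p - dir_deriv U (dir_deriv W V) p"
    if "smooth U" "smooth V" "smooth W" for U V W :: "'a \<Rightarrow> 'a"
  proof -
    have "lie_bracket V W = (\<lambda>p. dir_deriv V W p - dir_deriv W V p)"
      by (simp add: lie_bracket_def fun_eq_iff)
    then show ?thesis
      using that by (simp add: dir_deriv_diff smooth_dir_deriv)
  qed
  show ?thesis
    unfolding lie_bracket_def[of X "lie_bracket _ _"] lie_bracket_def[of Y "lie_bracket _ _"]
      lie_bracket_def[of "lie_bracket _ _" Z]
    using assms by (simp add: * dir_deriv_lie_bracket)
qed

subsection \<open>Connections\<close>

definition curvature ::
    "(('a::euclidean_space \<Rightarrow> 'a) \<Rightarrow> ('a \<Rightarrow> 'a) \<Rightarrow> 'a \<Rightarrow> 'a)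
      \<Rightarrow> ('a \<Rightarrow> 'a) \<Rightarrow> ('a \<Rightarrow> 'a) \<Rightarrow> ('a \<Rightarrow> 'a) \<Rightarrow> 'a \<Rightarrow> 'a" where
  "curvature D Y Z W p = D Y (D Z W) p - D Z (D Y W) p - D (lie_bracket Y Z) W p"

text \<open>The value at (Y, Z) of the Lie derivative of the connection, the obstruction to X being
  affine.\<close>

definition lie_deriv_connection ::
    "(('a::euclidean_space \<Rightarrow> 'a) \<Rightarrow> ('a \<Rightarrow> 'a) \<Rightarrow> 'a \<Rightarrow> 'a)
      \<Rightarrow> ('a \<Rightarrow> 'a) \<Rightarrow> ('a \<Rightarrow> 'a) \<Rightarrow> ('a \<Rightarrow> 'a) \<Rightarrow> 'a \<Rightarrow> 'a" where
  "lie_deriv_connection D X Y Z p =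
     lie_bracket X (D Y Z) p - D (lie_bracket X Y) Z p - D Y (lie_bracket X Z) p"

context
  fixes D :: "('a::euclidean_space \<Rightarrow> 'a) \<Rightarrow> ('a \<Rightarrow> 'a) \<Rightarrow> 'a \<Rightarrow> 'a"
  assumes D: "affine_connection D"
begin

lemma smooth_connection: "smooth Y \<Longrightarrow> smooth Z \<Longrightarrow> smooth (D Y Z)"
  using D unfolding affine_connection_def by blast

lemma connection_add_left:
  "smooth Y \<Longrightarrow> smooth Y' \<Longrightarrow> smooth Z \<Longrightarrow>
     D (\<lambda>p. Y p + Y' p) Z = (\<lambda>p. D Y Z p + D Y' Z p)"
  using D unfolding affine_connection_def by blast

lemma connection_scaleR_left:
  "smooth h \<Longrightarrow> smooth Y \<Longrightarrow> smooth Z \<Longrightarrow>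
     D (\<lambda>p. h p *\<^sub>R Y p) Z = (\<lambda>p. h p *\<^sub>R D Y Z p)"
  using D unfolding affine_connection_def by blast

lemma connection_add_right:
  "smooth Y \<Longrightarrow> smooth Z \<Longrightarrow> smooth Z' \<Longrightarrow>
     D Y (\<lambda>p. Z p + Z' p) = (\<lambda>p. D Y Z p + D Y Z' p)"
  using D unfolding affine_connection_def by blast

lemma connection_scaleR_right:
  "smooth h \<Longrightarrow> smooth Y \<Longrightarrow> smooth Z \<Longrightarrow>
     D Y (\<lambda>p. h p *\<^sub>R Z p) = (\<lambda>p. dir_deriv Y h p *\<^sub>R Z p + h p *\<^sub>R D Y Z p)"
  using D unfolding affine_connection_def by blast

lemma connection_diff_left:
  assumes "smooth Y" "smooth Y'" "smooth Z"
  shows "D (\<lambda>p. Y p - Y' p) Z = (\<lambda>p. D Y Z p - D Y' Z p)"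
  using connection_add_left[of Y "\<lambda>p. (-1) *\<^sub>R Y' p" Z]
    connection_scaleR_left[of "\<lambda>_. -1" Y' Z] assms
  by (simp add: smooth_intros)

lemmas connection_simps =
  connection_add_left connection_add_right connection_scaleR_left connection_scaleR_right
  connection_diff_left

lemma curvature_swap:
  assumes "smooth Y" "smooth Z" "smooth W"
  shows "curvature D Z Y W p = - curvature D Y Z W p"
proof -
  have "lie_bracket Z Y = (\<lambda>p. (-1) *\<^sub>R lie_bracket Y Z p)"
    by (simp add: fun_eq_iff lie_bracket_commute[of Y])
  then have "D (lie_bracket Z Y) W p = - D (lie_bracket Y Z) W p"
    using connection_scaleR_left[of "\<lambda>_. -1" "lie_bracket Y Z" W] assms
    by (simp add: smooth_intros)
  then show ?thesis
    by (simp add: curvature_def)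
qed

lemma curvature_self:
  assumes "smooth Y" "smooth W"
  shows "curvature D Y Y W p = 0"
proof -
  have "2 *\<^sub>R curvature D Y Y W p = 0"
    unfolding scaleR_2 using curvature_swap[OF assms(1,1,2), of p] by (simp add: eq_neg_iff_add_eq_0)
  then show ?thesis
    by simp
qed

lemma curvature_add_left:
  assumes "smooth Y" "smooth Y'" "smooth Z" "smooth W"
  shows "curvature D (\<lambda>p. Y p + Y' p) Z W p = curvature D Y Z W p + curvature D Y' Z W p"
proof -
  have "lie_bracket (\<lambda>p. Y p + Y' p) Z = (\<lambda>p. lie_bracket Y Z p + lie_bracket Y' Z p)"
    by (simp add: fun_eq_iff lie_bracket_add_left assms)
  then show ?thesis
    by (simp add: curvature_def assms connection_simps smooth_connection smooth_lie_bracket)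
qed

text \<open>The derivative of \<open>h\<close> produced by \<open>D Z\<close> is cancelled by the
  one that the bracket produces.\<close>

lemma curvature_scaleR_left:
  assumes "smooth h" "smooth Y" "smooth Z" "smooth W"
  shows "curvature D (\<lambda>p. h p *\<^sub>R Y p) Z W p = h p *\<^sub>R curvature D Y Z W p"
proof -
  have "lie_bracket (\<lambda>p. h p *\<^sub>R Y p) Z =
      (\<lambda>p. h p *\<^sub>R lie_bracket Y Z p - dir_deriv Z h p *\<^sub>R Y p)"
    by (simp add: fun_eq_iff lie_bracket_scaleR_left assms)
  then show ?thesis
    by (simp add: curvature_def assms connection_simps smooth_connection smooth_intros algebra_simps)
qed

lemma curvature_add_right:
  assumes "smooth Y" "smooth Z" "smooth W" "smooth W'"
  shows "curvature D Y Z (\<lambda>p. W p + W' p) p = curvature D Y Z W p + curvature D Y Z W' p"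
  by (simp add: curvature_def assms connection_simps smooth_connection smooth_lie_bracket)

text \<open>The second derivatives of \<open>h\<close> occur as Y Z h - Z Y h - [Y, Z] h, which is
  zero by \<open>dir_deriv_lie_bracket\<close>; the mixed first-order terms cancel in pairs.\<close>

lemma curvature_scaleR_right:
  assumes "smooth h" "smooth Y" "smooth Z" "smooth W"
  shows "curvature D Y Z (\<lambda>p. h p *\<^sub>R W p) p = h p *\<^sub>R curvature D Y Z W p"
  by (simp add: curvature_def assms connection_simps smooth_connection smooth_intros
      dir_deriv_lie_bracket algebra_simps)

section \<open>Lie derivative of a connection and its effect on the curvature\<close>

context
  fixes X :: "'a \<Rightarrow> 'a"
  assumes X: "smooth X"
begin

lemma lie_bracket_add_eq:
  "smooth Y \<Longrightarrow> smooth Y' \<Longrightarrow>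
     lie_bracket X (\<lambda>p. Y p + Y' p) = (\<lambda>p. lie_bracket X Y p + lie_bracket X Y' p)"
  by (simp add: fun_eq_iff lie_bracket_add_right X)

lemma lie_bracket_scaleR_eq:
  "smooth h \<Longrightarrow> smooth Y \<Longrightarrow>
     lie_bracket X (\<lambda>p. h p *\<^sub>R Y p) = (\<lambda>p. dir_deriv X h p *\<^sub>R Y p + h p *\<^sub>R lie_bracket X Y p)"
  by (simp add: fun_eq_iff lie_bracket_scaleR_right X)

lemma lie_deriv_connection_add_left:
  assumes "smooth Y" "smooth Y'" "smooth Z"
  shows "lie_deriv_connection D X (\<lambda>p. Y p + Y' p) Z p =
    lie_deriv_connection D X Y Z p + lie_deriv_connection D X Y' Z p"
  by (simp add: lie_deriv_connection_def lie_bracket_add_eq assms connection_simps X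
      smooth_connection smooth_lie_bracket)

lemma lie_deriv_connection_add_right:
  assumes "smooth Y" "smooth Z" "smooth Z'"
  shows "lie_deriv_connection D X Y (\<lambda>p. Z p + Z' p) p =
    lie_deriv_connection D X Y Z p + lie_deriv_connection D X Y Z' p"
  by (simp add: lie_deriv_connection_def lie_bracket_add_eq assms connection_simps X
      smooth_connection smooth_lie_bracket)

lemma lie_deriv_connection_scaleR_left:
  assumes "smooth h" "smooth Y" "smooth Z"
  shows "lie_deriv_connection D X (\<lambda>p. h p *\<^sub>R Y p) Z p = h p *\<^sub>R lie_deriv_connection D X Y Z p"
  by (simp add: lie_deriv_connection_def lie_bracket_scaleR_eq assms connection_simps X
      smooth_connection smooth_intros algebra_simps)

text \<open>The derivatives of \<open>h\<close> that do not cancel in pairs combine to X Y h -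
  [X, Y] h - Y X h, which is zero.\<close>

lemma lie_deriv_connection_scaleR_right:
  assumes "smooth h" "smooth Y" "smooth Z"
  shows "lie_deriv_connection D X Y (\<lambda>p. h p *\<^sub>R Z p) p = h p *\<^sub>R lie_deriv_connection D X Y Z p"
  by (simp add: lie_deriv_connection_def lie_bracket_scaleR_eq lie_bracket_add_eq assms
      connection_simps X smooth_connection smooth_intros dir_deriv_lie_bracket algebra_simps)

text \<open>Bracketing with an affine \<open>X\<close> obeys the Leibniz rule on each
  \<open>D\<close>. Applied twice to the iterated derivatives, and combined with the Jacobi identity
  for the bracket term, this gives the Leibniz rule for the curvature.\<close>

lemma lie_bracket_curvature:
  assumes affine: "\<And>Y Z p. smooth Y \<Longrightarrow> smooth Z \<Longrightarrow> lie_deriv_connection D X Y Z p = 0"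
    and "smooth Y" "smooth Z" "smooth W"
  shows "lie_bracket X (curvature D Y Z W) p =
    curvature D (lie_bracket X Y) Z W p + curvature D Y (lie_bracket X Z) W p +
    curvature D Y Z (lie_bracket X W) p"
proof -
  have L: "lie_bracket X (D U V) = (\<lambda>p. D (lie_bracket X U) V p + D U (lie_bracket X V) p)"
    if "smooth U" "smooth V" for U V
    using affine[OF that] by (simp add: lie_deriv_connection_def fun_eq_iff algebra_simps)
  have J: "lie_bracket X (lie_bracket Y Z) =
      (\<lambda>p. lie_bracket (lie_bracket X Y) Z p + lie_bracket Y (lie_bracket X Z) p)"
    by (rule ext) (rule lie_bracket_jacobi[OF X assms(2,3)])
  have "lie_bracket X (curvature D Y Z W) p =
      lie_bracket X (D Y (D Z W)) p - lie_bracket X (D Z (D Y W)) p -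
      lie_bracket X (D (lie_bracket Y Z) W) p"
    by (simp add: curvature_def[abs_def] lie_bracket_diff_right assms X smooth_connection smooth_intros)
  then show ?thesis
    by (simp add: curvature_def L J assms X connection_simps smooth_connection smooth_lie_bracket)
qed

end

end

section \<open>Existence and uniqueness of the Levi-Civita connection\<close>

lemma levi_civita_properties:
  assumes "affine_connection D" "torsion_free D" "metric_compatible g D"
  shows "affine_connection (levi_civita g)" "torsion_free (levi_civita g)"
    "metric_compatible g (levi_civita g)"
  using someI[where x = D, of "\<lambda>D. affine_connection D \<and> torsion_free D \<and> metric_compatible g D"] assms
  unfolding levi_civita_def by blast+

text \<open>The difference S of two such connections is symmetric in its two arguments, while g(S(U,
  V), W) is skew in V and W. Alternating the two symmetries brings g(S(Y, Z), W) back to its own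
  negative.\<close>

lemma levi_civita_unique:
  assumes sym: "\<And>p v w. g p v w = g p w v"
    and add: "\<And>p u v w. g p (u + v) w = g p u w + g p v w"
    and nondeg: "\<And>p v. (\<And>w. g p v w = 0) \<Longrightarrow> v = 0"
    and D: "torsion_free D" "metric_compatible g D"
    and D': "torsion_free D'" "metric_compatible g D'"
    and Y: "smooth Y" and Z: "smooth Z"
  shows "D Y Z p = D' Y Z p"
proof -
  define S where "S Y Z = D Y Z p - D' Y Z p" for Y Z
  have S_sym: "S U V = S V U" if "smooth U" "smooth V" for U V
  proof -
    have "D U V p - D V U p = D' U V p - D' V U p"
      using D(1) D'(1) that unfolding torsion_free_def by metis
    then show ?thesis
      by (simp add: S_def algebra_simps)
  qed
  have g_S: "g p (S U V) w = g p (D U V p) w - g p (D' U V p) w" for U V w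
    using add[of p "S U V" "D' U V p" w] by (simp add: S_def)
  have S_skew: "g p (S U V) (W p) = - g p (S U W) (V p)"
    if "smooth U" "smooth V" "smooth W" for U V W
  proof -
    have "dir_deriv U (\<lambda>p. g p (V p) (W p)) p = g p (E U V p) (W p) + g p (V p) (E U W p)"
      if "metric_compatible g E" for E
      using that \<open>smooth U\<close> \<open>smooth V\<close> \<open>smooth W\<close> unfolding metric_compatible_def by simp
    from this[OF D(2)] this[OF D'(2)] show ?thesis
      by (simp add: g_S sym[of p "V p"])
  qed
  have "g p (S Y Z) w = 0" for w
  proof -
    \<comment> \<open>Non-degeneracy speaks of vectors at \<open>p\<close>, compatibility of smooth
      fields; the constant field extends \<open>w\<close>.\<close>
    define W where "W = (\<lambda>_ :: 'a. w)"
    have W: "smooth W"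
      unfolding W_def by (intro smooth_intros)
    have "g p (S Y Z) (W p) = - g p (S W Y) (Z p)"
      by (simp add: S_skew[OF Y Z W] S_sym[OF Y W])
    also have "\<dots> = g p (S Z W) (Y p)"
      by (simp add: S_skew[OF W Y Z] S_sym[OF W Z])
    also have "\<dots> = - g p (S Y Z) (W p)"
      by (simp add: S_skew[OF Z W Y] S_sym[OF Z Y])
    finally show ?thesis
      by (simp add: W_def)
  qed
  then have "S Y Z = 0"
    by (rule nondeg)
  then show ?thesis
    by (simp add: S_def)
qed

subsection \<open>The Levi-Civita connection of the metric on the Heisenberg group\<close>

text \<open>The Christoffel symbols of \<open>heis_g2\<close> in the coordinates x, y, z, contracted
  with \<open>u\<close> and \<open>v\<close>.\<close>

definition heis_christoffel :: "real \<Rightarrow> real ^ 3 \<Rightarrow> real ^ 3 \<Rightarrow> real ^ 3 \<Rightarrow> real ^ 3" where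
  "heis_christoffel lam p u v = vector
     [lam\<^sup>2 / 2 * (u $ 2 * v $ 3 + u $ 3 * v $ 2) + lam\<^sup>2 * p $ 1 * u $ 2 * v $ 2,
      - (u $ 1 * v $ 3 + u $ 3 * v $ 1) / 2 - p $ 1 / 2 * (u $ 1 * v $ 2 + u $ 2 * v $ 1),
      p $ 1 / 2 * (u $ 1 * v $ 3 + u $ 3 * v $ 1) +
        (1 + (p $ 1)\<^sup>2) / 2 * (u $ 1 * v $ 2 + u $ 2 * v $ 1)]"

definition heis_connection ::
    "real \<Rightarrow> (real ^ 3 \<Rightarrow> real ^ 3) \<Rightarrow> (real ^ 3 \<Rightarrow> real ^ 3) \<Rightarrow> real ^ 3 \<Rightarrow> real ^ 3" where
  "heis_connection lam Y Z p = dir_deriv Y Z p + heis_christoffel lam p (Y p) (Z p)"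

lemma heis_christoffel_bilinear:
  "heis_christoffel lam p (u + u') v = heis_christoffel lam p u v + heis_christoffel lam p u' v"
  "heis_christoffel lam p (a *\<^sub>R u) v = a *\<^sub>R heis_christoffel lam p u v"
  "heis_christoffel lam p u (v + v') = heis_christoffel lam p u v + heis_christoffel lam p u v'"
  "heis_christoffel lam p u (a *\<^sub>R v) = a *\<^sub>R heis_christoffel lam p u v"
  by (simp_all add: heis_christoffel_def vec_eq_iff forall_3 field_simps)

lemma heis_christoffel_commute: "heis_christoffel lam p u v = heis_christoffel lam p v u"
  by (simp add: heis_christoffel_def vec_eq_iff forall_3 algebra_simps)

lemma smooth_heis_christoffel:
  assumes "smooth Y" "smooth Z"
  shows "smooth (\<lambda>p. heis_christoffel lam p (Y p) (Z p))"
  unfolding heis_christoffel_def divide_inverse by (intro smooth_intros assms)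

lemma affine_connection_heis: "affine_connection (heis_connection lam)"
  unfolding affine_connection_def heis_connection_def[abs_def]
  by (auto simp: fun_eq_iff dir_deriv_simps heis_christoffel_bilinear algebra_simps
      intro!: smooth_intros smooth_heis_christoffel)

lemma torsion_free_heis: "torsion_free (heis_connection lam)"
  unfolding torsion_free_def heis_connection_def
  by (auto simp: fun_eq_iff lie_bracket_def heis_christoffel_commute)

lemma metric_compatible_heis:
  assumes "lam \<noteq> 0"
  shows "metric_compatible (heis_g2 lam) (heis_connection lam)"
proof -
  have "dir_deriv Y (\<lambda>p. heis_g2 lam p (Z p) (W p)) p =
      heis_g2 lam p (heis_connection lam Y Z p) (W p) + heis_g2 lam p (Z p) (heis_connection lam Y W p)"
    if YZW: "smooth Y" "smooth Z" "smooth W" for Y Z W p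
  proof -
    have "dir_deriv Y (\<lambda>p. heis_g2 lam p (Z p) (W p)) p =
       1 / lam\<^sup>2 * (Z p $ 1 * dir_deriv Y W p $ 1 + dir_deriv Y Z p $ 1 * W p $ 1)
       + (Z p $ 2 * dir_deriv Y W p $ 2 + dir_deriv Y Z p $ 2 * W p $ 2)
       - ((p $ 1 * Z p $ 2 + Z p $ 3) *
          (p $ 1 * dir_deriv Y W p $ 2 + Y p $ 1 * W p $ 2 + dir_deriv Y W p $ 3) +
          (p $ 1 * dir_deriv Y Z p $ 2 + Y p $ 1 * Z p $ 2 + dir_deriv Y Z p $ 3) *
          (p $ 1 * W p $ 2 + W p $ 3))"
      unfolding heis_g2_def
      by (simp add: dir_deriv_simps smooth_intros YZW)
    also have "\<dots> =
        heis_g2 lam p (heis_connection lam Y Z p) (W p) + heis_g2 lam p (Z p) (heis_connection lam Y W p)"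
      using assms
      by (simp add: heis_connection_def heis_christoffel_def heis_g2_def field_simps power2_eq_square)
    finally show ?thesis .
  qed
  then show ?thesis
    by (simp add: metric_compatible_def fun_eq_iff)
qed

section \<open>Brackets, connection and curvature on the left-invariant frame\<close>

lemma smooth_heis_frame [smooth_intros]:
  "smooth heis_e1" "smooth (heis_e2 lam)" "smooth heis_e3"
  unfolding heis_e1_def[abs_def] heis_e2_def[abs_def] heis_e3_def[abs_def]
  by (intro smooth_intros)+

lemma dir_deriv_heis_frame:
  "dir_deriv X heis_e1 p = vector [0, 0, - X p $ 1]"
  "dir_deriv X (heis_e2 lam) p = 0"
  "dir_deriv X heis_e3 p = 0"
  unfolding heis_e1_def[abs_def] heis_e2_def[abs_def] heis_e3_def[abs_def]
  by (simp_all add: dir_deriv_simps smooth_intros)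

lemma lie_bracket_heis_frame:
  "lie_bracket heis_e1 (heis_e2 lam) = (\<lambda>p. lam *\<^sub>R heis_e3 p)"
  "lie_bracket (heis_e2 lam) heis_e1 = (\<lambda>p. - lam *\<^sub>R heis_e3 p)"
  "lie_bracket heis_e1 heis_e3 = (\<lambda>p. 0)"
  "lie_bracket heis_e3 heis_e1 = (\<lambda>p. 0)"
  "lie_bracket (heis_e2 lam) heis_e3 = (\<lambda>p. 0)"
  "lie_bracket heis_e3 (heis_e2 lam) = (\<lambda>p. 0)"
  "lie_bracket Y Y = (\<lambda>p. 0)"
  by (simp_all add: fun_eq_iff lie_bracket_def dir_deriv_heis_frame vec_eq_iff forall_3)
     (simp_all add: heis_e1_def heis_e2_def heis_e3_def)

context
  fixes lam :: real
  assumes lam: "lam \<noteq> 0"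
begin

private abbreviation (input) "e1 \<equiv> heis_e1"
private abbreviation (input) "e2 \<equiv> heis_e2 lam"
private abbreviation (input) "e3 \<equiv> heis_e3"
private abbreviation (input) "D \<equiv> levi_civita (heis_g2 lam)"

lemma heis_frame_decomposition:
  "v = v $ 2 *\<^sub>R e1 p + (v $ 1 / lam) *\<^sub>R e2 p + (p $ 1 * v $ 2 + v $ 3) *\<^sub>R e3 p"
  using lam by (simp add: vec_eq_iff forall_3 heis_e1_def heis_e2_def heis_e3_def)

lemma heis_frame_independent:
  "a *\<^sub>R e1 p + b *\<^sub>R e2 p + c *\<^sub>R e3 p = a' *\<^sub>R e1 p + b' *\<^sub>R e2 p + c' *\<^sub>R e3 p \<longleftrightarrow>
     a = a' \<and> b = b' \<and> c = c'"
  using lam by (auto simp add: vec_eq_iff forall_3 heis_e1_def heis_e2_def heis_e3_def)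

lemmas heis_levi_civita =
  levi_civita_properties[OF affine_connection_heis torsion_free_heis metric_compatible_heis[OF lam]]

lemma levi_civita_heis_eq:
  assumes "smooth Y" "smooth Z"
  shows "D Y Z = heis_connection lam Y Z"
proof
  fix p
  show "D Y Z p = heis_connection lam Y Z p"
  proof (rule levi_civita_unique[OF _ _ _ heis_levi_civita(2,3) torsion_free_heis
        metric_compatible_heis[OF lam] assms])
    fix p v w
    show "heis_g2 lam p v w = heis_g2 lam p w v"
      by (simp add: heis_g2_def algebra_simps)
  next
    fix p u v w
    show "heis_g2 lam p (u + v) w = heis_g2 lam p u w + heis_g2 lam p v w"
      by (simp add: heis_g2_def algebra_simps)
  next
    fix p v
    assume "\<And>w. heis_g2 lam p v w = 0"
    from this[of "e1 p"] this[of "e2 p"] this[of "e3 p"] show "v = 0"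
      using lam by (simp add: heis_g2_def heis_e1_def heis_e2_def heis_e3_def vec_eq_iff forall_3)
  qed
qed

text \<open>On the frame the dependence of the Christoffel symbols on x cancels against the
  derivative of \<open>heis_e1\<close>, as left invariance predicts. From here on the calculation
  uses constants only.\<close>

lemma levi_civita_heis_frame:
  "D e1 e1 = (\<lambda>p. 0)" "D e2 e2 = (\<lambda>p. 0)" "D e3 e3 = (\<lambda>p. 0)"
  "D e1 e2 = (\<lambda>p. (lam / 2) *\<^sub>R e3 p)" "D e2 e1 = (\<lambda>p. (- lam / 2) *\<^sub>R e3 p)"
  "D e1 e3 = (\<lambda>p. (lam / 2) *\<^sub>R e2 p)" "D e3 e1 = (\<lambda>p. (lam / 2) *\<^sub>R e2 p)"
  "D e2 e3 = (\<lambda>p. (- lam / 2) *\<^sub>R e1 p)" "D e3 e2 = (\<lambda>p. (- lam / 2) *\<^sub>R e1 p)"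
  unfolding levi_civita_heis_eq[OF smooth_heis_frame(1,1)] levi_civita_heis_eq[OF smooth_heis_frame(2,2)]
    levi_civita_heis_eq[OF smooth_heis_frame(3,3)] levi_civita_heis_eq[OF smooth_heis_frame(1,2)]
    levi_civita_heis_eq[OF smooth_heis_frame(2,1)] levi_civita_heis_eq[OF smooth_heis_frame(1,3)]
    levi_civita_heis_eq[OF smooth_heis_frame(3,1)] levi_civita_heis_eq[OF smooth_heis_frame(2,3)]
    levi_civita_heis_eq[OF smooth_heis_frame(3,2)]
  by (simp_all add: heis_connection_def fun_eq_iff dir_deriv_heis_frame heis_christoffel_def
      heis_e1_def heis_e2_def heis_e3_def vec_eq_iff forall_3 power2_eq_square field_simps)

lemma connection_scaleR_const_right:
  "smooth Y \<Longrightarrow> smooth Z \<Longrightarrow> D Y (\<lambda>p. c *\<^sub>R Z p) = (\<lambda>p. c *\<^sub>R D Y Z p)"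
  by (simp add: connection_scaleR_right[OF heis_levi_civita(1)] smooth_intros dir_deriv_const)

lemma connection_scaleR_const_left:
  "smooth Y \<Longrightarrow> smooth Z \<Longrightarrow> D (\<lambda>p. c *\<^sub>R Y p) Z = (\<lambda>p. c *\<^sub>R D Y Z p)"
  by (simp add: connection_scaleR_left[OF heis_levi_civita(1)] smooth_intros)

lemma connection_zero:
  assumes "smooth Y"
  shows "D Y (\<lambda>p. 0) = (\<lambda>p. 0)" "D (\<lambda>p. 0) Y = (\<lambda>p. 0)"
  using connection_scaleR_const_right[OF assms assms, of 0] connection_scaleR_const_left[OF assms assms, of 0]
  by simp_all

lemmas heis_connection_simps = levi_civita_heis_frame lie_bracket_heis_frame connection_zero
  connection_scaleR_const_right connection_scaleR_const_left smooth_heis_frame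

text \<open>One orientation per plane is enough; the others follow from
  \<open>curvature_swap\<close> and \<open>curvature_self\<close>.\<close>

lemma curvature_heis_frame:
  "curvature D e1 e2 e1 = (\<lambda>p. (- 3 * lam\<^sup>2 / 4) *\<^sub>R e2 p)"
  "curvature D e1 e2 e2 = (\<lambda>p. (3 * lam\<^sup>2 / 4) *\<^sub>R e1 p)"
  "curvature D e1 e2 e3 = (\<lambda>p. 0)"
  "curvature D e1 e3 e1 = (\<lambda>p. (lam\<^sup>2 / 4) *\<^sub>R e3 p)"
  "curvature D e1 e3 e2 = (\<lambda>p. 0)"
  "curvature D e1 e3 e3 = (\<lambda>p. (lam\<^sup>2 / 4) *\<^sub>R e1 p)"
  "curvature D e2 e3 e1 = (\<lambda>p. 0)"
  "curvature D e2 e3 e2 = (\<lambda>p. (lam\<^sup>2 / 4) *\<^sub>R e3 p)"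
  "curvature D e2 e3 e3 = (\<lambda>p. (lam\<^sup>2 / 4) *\<^sub>R e2 p)"
  \<comment> \<open>The reversed rules move signs into the scalars and collect the multiples of one
    frame vector into a single coefficient.\<close>
  by (simp_all add: fun_eq_iff curvature_def heis_connection_simps power2_eq_square
      del: scaleR_minus_left flip: scaleR_minus_left scaleR_left.add scaleR_left.diff)

lemma curvature_heis_linear:
  assumes "smooth a1" "smooth a2" "smooth a3" "smooth Y" "smooth Z"
  shows "curvature D (\<lambda>p. a1 p *\<^sub>R e1 p + a2 p *\<^sub>R e2 p + a3 p *\<^sub>R e3 p) Y Z p =
      a1 p *\<^sub>R curvature D e1 Y Z p + a2 p *\<^sub>R curvature D e2 Y Z p + a3 p *\<^sub>R curvature D e3 Y Z p"
    and "curvature D Y (\<lambda>p. a1 p *\<^sub>R e1 p + a2 p *\<^sub>R e2 p + a3 p *\<^sub>R e3 p) Z p =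
      a1 p *\<^sub>R curvature D Y e1 Z p + a2 p *\<^sub>R curvature D Y e2 Z p + a3 p *\<^sub>R curvature D Y e3 Z p"
    and "curvature D Y Z (\<lambda>p. a1 p *\<^sub>R e1 p + a2 p *\<^sub>R e2 p + a3 p *\<^sub>R e3 p) p =
      a1 p *\<^sub>R curvature D Y Z e1 p + a2 p *\<^sub>R curvature D Y Z e2 p + a3 p *\<^sub>R curvature D Y Z e3 p"
proof -
  note [simp] = assms smooth_intros
  note swap = curvature_swap[OF heis_levi_civita(1)]
  note left = curvature_add_left[OF heis_levi_civita(1)] curvature_scaleR_left[OF heis_levi_civita(1)]
  have *: "curvature D (\<lambda>p. a1 p *\<^sub>R e1 p + a2 p *\<^sub>R e2 p + a3 p *\<^sub>R e3 p) Y Z p =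
      a1 p *\<^sub>R curvature D e1 Y Z p + a2 p *\<^sub>R curvature D e2 Y Z p + a3 p *\<^sub>R curvature D e3 Y Z p"
    if "smooth Y" "smooth Z" for Y Z
    using that by (simp add: left)
  show "curvature D (\<lambda>p. a1 p *\<^sub>R e1 p + a2 p *\<^sub>R e2 p + a3 p *\<^sub>R e3 p) Y Z p =
      a1 p *\<^sub>R curvature D e1 Y Z p + a2 p *\<^sub>R curvature D e2 Y Z p + a3 p *\<^sub>R curvature D e3 Y Z p"
    by (rule *) simp_all
  show "curvature D Y (\<lambda>p. a1 p *\<^sub>R e1 p + a2 p *\<^sub>R e2 p + a3 p *\<^sub>R e3 p) Z p =
      a1 p *\<^sub>R curvature D Y e1 Z p + a2 p *\<^sub>R curvature D Y e2 Z p + a3 p *\<^sub>R curvature D Y e3 Z p"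
    using *[of Y]
    by (simp add: swap[of _ Y Z])
  show "curvature D Y Z (\<lambda>p. a1 p *\<^sub>R e1 p + a2 p *\<^sub>R e2 p + a3 p *\<^sub>R e3 p) p =
      a1 p *\<^sub>R curvature D Y Z e1 p + a2 p *\<^sub>R curvature D Y Z e2 p + a3 p *\<^sub>R curvature D Y Z e3 p"
    by (simp add: curvature_add_right[OF heis_levi_civita(1)] curvature_scaleR_right[OF heis_levi_civita(1)])
qed

lemma affine_vector_field_iff:
  "affine_vector_field (heis_g2 lam) X \<longleftrightarrow>
     smooth X \<and> (\<forall>Y Z p. smooth Y \<longrightarrow> smooth Z \<longrightarrow> lie_deriv_connection D X Y Z p = 0)"
  unfolding affine_vector_field_def lie_deriv_connection_def by (auto simp: fun_eq_iff algebra_simps)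

text \<open>The frame spans every tangent space, so the whole derivative vanishes. This replaces
  solving differential equations: a candidate polynomial is subtracted and the remainder is
  constant.\<close>

lemma constant_if_frame_derivs_zero:
  fixes g :: "real ^ 3 \<Rightarrow> real"
  assumes g: "smooth g"
    and "\<And>p. dir_deriv e1 g p = 0" "\<And>p. dir_deriv e2 g p = 0" "\<And>p. dir_deriv e3 g p = 0"
  shows "g p = g q"
proof -
  have "frechet_derivative g (at p) v = 0" for p v
  proof -
    interpret linear "frechet_derivative g (at p)"
      by (rule has_derivative_linear[OF smooth_has_derivative[OF g]])
    show ?thesis
      using assms(2-4)[of p] by (subst heis_frame_decomposition[of v p]) (simp add: add scale dir_deriv_def)
  qed
  then have "frechet_derivative g (at p) = (\<lambda>v. 0)" for p
    by blast
  then have "(g has_derivative (\<lambda>v. 0)) (at p within UNIV)" for p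
    using smooth_has_derivative[OF g, of p] by simp
  then obtain c where "\<And>p. g p = c"
    using has_derivative_zero_constant[OF convex_UNIV, of g] by blast
  then show ?thesis
    by simp
qed

section \<open>The first-order system for the coefficients of an affine field\<close>

context
  fixes f1 f2 f3 :: "real ^ 3 \<Rightarrow> real"
  assumes f: "smooth f1" "smooth f2" "smooth f3"
begin

private abbreviation (input) "X \<equiv> (\<lambda>p. f1 p *\<^sub>R e1 p + f2 p *\<^sub>R e2 p + f3 p *\<^sub>R e3 p)"

lemma smooth_heis_field: "smooth X"
  by (intro smooth_intros f)

lemma lie_bracket_heis_field:
  "lie_bracket X e1 = (\<lambda>p. (- dir_deriv e1 f1 p) *\<^sub>R e1 p + (- dir_deriv e1 f2 p) *\<^sub>R e2 p +
     (- dir_deriv e1 f3 p - lam * f2 p) *\<^sub>R e3 p)"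
  "lie_bracket X e2 = (\<lambda>p. (- dir_deriv e2 f1 p) *\<^sub>R e1 p + (- dir_deriv e2 f2 p) *\<^sub>R e2 p +
     (- dir_deriv e2 f3 p + lam * f1 p) *\<^sub>R e3 p)"
  "lie_bracket X e3 = (\<lambda>p. (- dir_deriv e3 f1 p) *\<^sub>R e1 p + (- dir_deriv e3 f2 p) *\<^sub>R e2 p +
     (- dir_deriv e3 f3 p) *\<^sub>R e3 p)"
  by (simp_all add: fun_eq_iff lie_bracket_add_left lie_bracket_scaleR_left f smooth_intros
      lie_bracket_heis_frame algebra_simps)

lemma heis_affine_field_pde:
  assumes affine: "affine_vector_field (heis_g2 lam) X"
  shows "dir_deriv e1 f1 p = 0" "dir_deriv e2 f2 p = 0"
    and "dir_deriv e3 f1 p = 0" "dir_deriv e3 f2 p = 0" "dir_deriv e3 f3 p = 0"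
    and "dir_deriv e1 f2 p = - dir_deriv e2 f1 p"
    and "dir_deriv e1 f3 p = - lam * f2 p" "dir_deriv e2 f3 p = lam * f1 p"
proof -
  define V where "V = X"
  have V: "smooth V"
    unfolding V_def by (rule smooth_heis_field)
  \<comment> \<open>The frame coefficients of [X, e1], [X, e2], [X, e3], treated below as nine
    unknowns in equations that are linear at each point.\<close>
  define a1 a2 a3 where "a1 p = - dir_deriv e1 f1 p" and "a2 p = - dir_deriv e1 f2 p"
    and "a3 p = - dir_deriv e1 f3 p - lam * f2 p" for p
  define b1 b2 b3 where "b1 p = - dir_deriv e2 f1 p" and "b2 p = - dir_deriv e2 f2 p"
    and "b3 p = - dir_deriv e2 f3 p + lam * f1 p" for p
  define c1 c2 c3 where "c1 p = - dir_deriv e3 f1 p" and "c2 p = - dir_deriv e3 f2 p"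
    and "c3 p = - dir_deriv e3 f3 p" for p
  note m_def = a1_def a2_def a3_def b1_def b2_def b3_def c1_def c2_def c3_def
  have m: "smooth a1" "smooth a2" "smooth a3" "smooth b1" "smooth b2" "smooth b3"
    "smooth c1" "smooth c2" "smooth c3"
    unfolding m_def[abs_def] by (intro smooth_intros f)+
  have L: "lie_bracket V e1 = (\<lambda>p. a1 p *\<^sub>R e1 p + a2 p *\<^sub>R e2 p + a3 p *\<^sub>R e3 p)"
    "lie_bracket V e2 = (\<lambda>p. b1 p *\<^sub>R e1 p + b2 p *\<^sub>R e2 p + b3 p *\<^sub>R e3 p)"
    "lie_bracket V e3 = (\<lambda>p. c1 p *\<^sub>R e1 p + c2 p *\<^sub>R e2 p + c3 p *\<^sub>R e3 p)"
    unfolding V_def lie_bracket_heis_field m_def by (rule refl)+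
  have Lc: "lie_bracket V (\<lambda>p. c *\<^sub>R Y p) p = c *\<^sub>R lie_bracket V Y p" if "smooth Y" for c Y
    by (simp add: lie_bracket_scaleR_right that V smooth_const dir_deriv_const)
  \<comment> \<open>The simplifier pulls a minus sign out of a scalar multiple, so \<open>Lc\<close>
    alone would not match the negative curvature coefficients.\<close>
  have Lm: "lie_bracket V (\<lambda>p. - (c *\<^sub>R Y p)) p = - (c *\<^sub>R lie_bracket V Y p)" if "smooth Y" for c Y
    using Lc[OF that, of "- c"] by simp
  have R: "lie_bracket V (curvature D Y Z W) p = curvature D (lie_bracket V Y) Z W p +
      curvature D Y (lie_bracket V Z) W p + curvature D Y Z (lie_bracket V W) p"
    if "smooth Y" "smooth Z" "smooth W" for Y Z W
    using affine[folded V_def] that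
    by (intro lie_bracket_curvature[OF heis_levi_civita(1) V]) (auto simp: affine_vector_field_iff)
  note swap = curvature_swap[OF heis_levi_civita(1), of e1 e2] curvature_swap[OF heis_levi_civita(1), of e1 e3]
    curvature_swap[OF heis_levi_civita(1), of e2 e3]
  note expand = L Lc Lm curvature_heis_linear m smooth_heis_frame curvature_heis_frame swap
    curvature_self[OF heis_levi_civita(1)]
  \<comment> \<open>In units of \<open>k\<close> the curvature coefficients are 1 and 3 up to sign,
    and \<open>k\<close> can be cancelled.\<close>
  define k where "k = lam\<^sup>2 / 4"
  have k: "k \<noteq> 0" "lam\<^sup>2 = 4 * k"
    using lam by (simp_all add: k_def)
  \<comment> \<open>Here the unequal curvatures act: R(e1, e2)e2 = 3k e1 but R(e3, e2)e2 = -k e3, so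
    the e3-component reads 3k a3 = -k a3 and forces a3 = 0. With constant curvature both factors
    would agree and this equation would be void. The same mechanism gives b3 = 0 in equation 2 and
    c2 = 0 in equation 3.\<close>
  have 1: "(3 * k * a1 p) *\<^sub>R e1 p + (3 * k * a2 p) *\<^sub>R e2 p + (3 * k * a3 p) *\<^sub>R e3 p =
      (3 * k * (a1 p + 2 * b2 p)) *\<^sub>R e1 p + (- 3 * k * b1 p) *\<^sub>R e2 p + (- k * a3 p) *\<^sub>R e3 p"
    using R[of e1 e2 e2] by (simp add: expand k(2)) (simp add: vec_eq_iff algebra_simps)
  have 2: "(- 3 * k * b1 p) *\<^sub>R e1 p + (- 3 * k * b2 p) *\<^sub>R e2 p + (- 3 * k * b3 p) *\<^sub>R e3 p =
      (3 * k * a2 p) *\<^sub>R e1 p + (- 3 * k * (b2 p + 2 * a1 p)) *\<^sub>R e2 p + (k * b3 p) *\<^sub>R e3 p"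
    using R[of e1 e2 e1] by (simp add: expand k(2)) (simp add: vec_eq_iff algebra_simps)
  have 3: "(k * c1 p) *\<^sub>R e1 p + (k * c2 p) *\<^sub>R e2 p + (k * c3 p) *\<^sub>R e3 p =
      (k * a3 p) *\<^sub>R e1 p + (- 3 * k * c2 p) *\<^sub>R e2 p + (k * (2 * a1 p + c3 p)) *\<^sub>R e3 p"
    using R[of e1 e3 e1] by (simp add: expand k(2)) (simp add: vec_eq_iff algebra_simps)
  have 4: "(k * a1 p) *\<^sub>R e1 p + (k * a2 p) *\<^sub>R e2 p + (k * a3 p) *\<^sub>R e3 p =
      (k * (a1 p + 2 * c3 p)) *\<^sub>R e1 p + (k * a2 p) *\<^sub>R e2 p + (k * c1 p) *\<^sub>R e3 p"
    using R[of e1 e3 e3] by (simp add: expand k(2)) (simp add: vec_eq_iff algebra_simps)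
  have "b2 p = 0" "k * (a2 p + b1 p) = 0" "a3 p = 0"
    using 1 k(1) unfolding heis_frame_independent by (auto simp: algebra_simps)
  moreover have "a1 p = 0" "b3 p = 0"
    using 2 k(1) unfolding heis_frame_independent by auto
  moreover have "c1 p = a3 p" "c2 p = 0"
    using 3 k(1) unfolding heis_frame_independent by auto
  moreover have "c3 p = 0"
    using 4 k(1) unfolding heis_frame_independent by auto
  moreover from \<open>k * (a2 p + b1 p) = 0\<close> have "a2 p = - b1 p"
    using k(1) by (simp add: add_eq_0_iff2)
  ultimately show "dir_deriv e1 f1 p = 0" "dir_deriv e2 f2 p = 0"
    "dir_deriv e3 f1 p = 0" "dir_deriv e3 f2 p = 0" "dir_deriv e3 f3 p = 0"
    "dir_deriv e1 f2 p = - dir_deriv e2 f1 p"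
    "dir_deriv e1 f3 p = - lam * f2 p" "dir_deriv e2 f3 p = lam * f1 p"
    by (simp_all add: m_def)
qed

end

section \<open>Integration of the first-order system\<close>

lemma heis_affine_field_integrate:
  assumes f: "smooth f1" "smooth f2" "smooth f3"
    and affine: "affine_vector_field (heis_g2 lam)
      (\<lambda>p. f1 p *\<^sub>R e1 p + f2 p *\<^sub>R e2 p + f3 p *\<^sub>R e3 p)"
  shows "\<exists>c1 c2 c3 c4. \<forall>p. f1 p = c1 * p $ 1 + c2 \<and> f2 p = - lam * c1 * p $ 2 + c3 \<and>
    f3 p = lam\<^sup>2 * c1 / 2 * (p $ 2)\<^sup>2 + c1 / 2 * (p $ 1)\<^sup>2 + c2 * p $ 1 - lam * c3 * p $ 2 + c4"
proof -
  note pde = heis_affine_field_pde[OF f affine]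
  note frame_nth = heis_e1_def heis_e2_def heis_e3_def
  define h where "h = dir_deriv e2 f1"
  have h: "smooth h"
    unfolding h_def by (intro smooth_intros f)
  have commute: "dir_deriv Y (dir_deriv Z g) p = dir_deriv Z (dir_deriv Y g) p + dir_deriv (lie_bracket Y Z) g p"
    if "smooth Y" "smooth Z" "smooth g" for Y Z p and g :: "real ^ 3 \<Rightarrow> real"
    using dir_deriv_lie_bracket[OF that(3,1,2), of p] by simp
  have zero: "dir_deriv Y g p = 0" if "\<And>q. g q = 0" for Y p and g :: "real ^ 3 \<Rightarrow> real"
    using that dir_deriv_const[of Y 0 p] by (simp add: fun_eq_iff[THEN iffD2, of g "\<lambda>_. 0"])
  have "h p = h q" for p q
  \<comment> \<open>Along e1 and e3 the derivative is commuted past e2 onto \<open>f1\<close>, where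
    it vanishes; for e1 the commutator adds lam times the derivative of \<open>f1\<close> along e3,
    which is also zero.\<close>
  proof (rule constant_if_frame_derivs_zero[OF h])
    fix p
    show "dir_deriv e1 h p = 0"
      unfolding h_def using lam pde
      by (simp add: commute[of e1 e2] smooth_heis_frame f zero lie_bracket_heis_frame dir_deriv_scaleR_field)
    show "dir_deriv e3 h p = 0"
      unfolding h_def using lam pde
      by (simp add: commute[of e3 e2] smooth_heis_frame f zero lie_bracket_heis_frame dir_deriv_def[of "\<lambda>_. 0"]
          linear_0[OF has_derivative_linear[OF smooth_has_derivative]])
    \<comment> \<open>Commuting gains nothing for e2 applied twice to \<open>f1\<close>. The
      rotation equation turns \<open>h\<close> into a derivative of \<open>f2\<close>, which e2
      annihilates, and the commutator leaves only a derivative along e3.\<close>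
    have "h = (\<lambda>p. - dir_deriv e1 f2 p)"
      using pde(6) by (simp add: h_def)
    then have "dir_deriv e2 h p = dir_deriv e2 (\<lambda>p. - dir_deriv e1 f2 p) p"
      by (rule arg_cong)
    also have "\<dots> = 0"
      using lam pde(2,4)
      by (simp add: dir_deriv_minus commute[of e2 e1] smooth_intros f zero lie_bracket_heis_frame
          dir_deriv_scaleR_field flip: scaleR_minus_left del: scaleR_minus_left)
    finally show "dir_deriv e2 h p = 0" .
  qed
  then obtain c where h_const: "\<And>p. h p = c"
    by metis
  \<comment> \<open>The derivative of x along e2 is lam, so the slope of \<open>f1\<close> in x is
    \<open>c / lam\<close>.\<close>
  define c1 where "c1 = c / lam"
  have e2f1: "dir_deriv e2 f1 p = lam * c1" for p
    using h_const lam by (simp add: h_def c1_def)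
  have const: "\<exists>c. \<forall>p. g p = c"
    if "smooth g" "\<And>p. dir_deriv e1 g p = 0" "\<And>p. dir_deriv e2 g p = 0" "\<And>p. dir_deriv e3 g p = 0"
    for g :: "real ^ 3 \<Rightarrow> real"
    using constant_if_frame_derivs_zero[OF that] by blast
  note deriv_simps = dir_deriv_simps smooth_intros f pde e2f1 frame_nth power2_eq_square
  have "\<exists>c2. \<forall>p. f1 p - c1 * p $ 1 = c2"
    by (rule const) (simp_all add: deriv_simps)
  then obtain c2 where "\<And>p. f1 p - c1 * p $ 1 = c2"
    by blast
  then have c2: "f1 p = c1 * p $ 1 + c2" for p
    by (simp add: diff_eq_eq add.commute)
  have "\<exists>c3. \<forall>p. f2 p + lam * c1 * p $ 2 = c3"
    by (rule const) (simp_all add: deriv_simps)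
  then obtain c3 where "\<And>p. f2 p + lam * c1 * p $ 2 = c3"
    by blast
  then have c3: "f2 p = - lam * c1 * p $ 2 + c3" for p
    by (simp add: eq_diff_eq)
  \<comment> \<open>The derivatives of \<open>f3\<close> along e1 and e2 are multiples of
    \<open>f2\<close> and \<open>f1\<close>, now known explicitly; the subtracted quadratic has the
    same derivatives along the frame.\<close>
  have "\<exists>c4. \<forall>p. f3 p - (lam\<^sup>2 * c1 / 2 * (p $ 2)\<^sup>2 + c1 / 2 * (p $ 1)\<^sup>2 + c2 * p $ 1 - lam * c3 * p $ 2) = c4"
    by (rule const) (simp_all add: deriv_simps c2 c3 algebra_simps)
  then obtain c4 where
    "\<And>p. f3 p - (lam\<^sup>2 * c1 / 2 * (p $ 2)\<^sup>2 + c1 / 2 * (p $ 1)\<^sup>2 + c2 * p $ 1 - lam * c3 * p $ 2) = c4"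
    by blast
  then have "f3 p = lam\<^sup>2 * c1 / 2 * (p $ 2)\<^sup>2 + c1 / 2 * (p $ 1)\<^sup>2 + c2 * p $ 1 - lam * c3 * p $ 2 + c4" for p
    by (simp add: algebra_simps)
  with c2 c3 show ?thesis
    by blast
qed

section \<open>The listed fields are affine\<close>

lemma lie_deriv_connection_zero_if_frame:
  assumes X: "smooth X" and YZ: "smooth Y" "smooth Z"
    and frame: "\<And>U V p. U \<in> {e1, e2, e3} \<Longrightarrow> V \<in> {e1, e2, e3} \<Longrightarrow> lie_deriv_connection D X U V p = 0"
  shows "lie_deriv_connection D X Y Z p = 0"
proof -
  have decomp: "\<exists>a1 a2 a3 :: real ^ 3 \<Rightarrow> real. smooth a1 \<and> smooth a2 \<and> smooth a3 \<and>
      W = (\<lambda>p. a1 p *\<^sub>R e1 p + a2 p *\<^sub>R e2 p + a3 p *\<^sub>R e3 p)" if W: "smooth W" for W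
  proof (intro exI conjI)
    show "W = (\<lambda>p. W p $ 2 *\<^sub>R e1 p + (W p $ 1 / lam) *\<^sub>R e2 p + (p $ 1 * W p $ 2 + W p $ 3) *\<^sub>R e3 p)"
      using heis_frame_decomposition by (rule ext)
  qed (intro smooth_intros W)+
  note simps = smooth_intros X
    lie_deriv_connection_add_left[OF heis_levi_civita(1)] lie_deriv_connection_add_right[OF heis_levi_civita(1)]
    lie_deriv_connection_scaleR_left[OF heis_levi_civita(1)] lie_deriv_connection_scaleR_right[OF heis_levi_civita(1)]
  have right: "lie_deriv_connection D X U Z p = 0" if U: "U \<in> {e1, e2, e3}" for U
  proof -
    have "smooth U"
      using U by (auto intro: smooth_intros)
    moreover obtain a1 a2 a3 where "smooth a1" "smooth a2" "smooth a3"
      "Z = (\<lambda>p. a1 p *\<^sub>R e1 p + a2 p *\<^sub>R e2 p + a3 p *\<^sub>R e3 p)"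
      using decomp[OF YZ(2)] by blast
    ultimately show ?thesis
      using frame[OF U, of e1] frame[OF U, of e2] frame[OF U, of e3] by (simp add: simps)
  qed
  obtain a1 a2 a3 where "smooth a1" "smooth a2" "smooth a3"
    "Y = (\<lambda>p. a1 p *\<^sub>R e1 p + a2 p *\<^sub>R e2 p + a3 p *\<^sub>R e3 p)"
    using decomp[OF YZ(1)] by blast
  then show ?thesis
    using right[of e1] right[of e2] right[of e3] YZ by (simp add: simps)
qed

lemma heis_field_affine:
  assumes f1: "\<And>p. f1 p = c1 * p $ 1 + c2" and f2: "\<And>p. f2 p = - lam * c1 * p $ 2 + c3"
    and f3: "\<And>p. f3 p =
      lam\<^sup>2 * c1 / 2 * (p $ 2)\<^sup>2 + c1 / 2 * (p $ 1)\<^sup>2 + c2 * p $ 1 - lam * c3 * p $ 2 + c4"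
  shows "affine_vector_field (heis_g2 lam)
    (\<lambda>p. f1 p *\<^sub>R e1 p + f2 p *\<^sub>R e2 p + f3 p *\<^sub>R e3 p)"
proof -
  have f_eq: "f1 = (\<lambda>p. c1 * p $ 1 + c2)" "f2 = (\<lambda>p. - lam * c1 * p $ 2 + c3)"
    "f3 = (\<lambda>p. lam\<^sup>2 * c1 / 2 * (p $ 2)\<^sup>2 + c1 / 2 * (p $ 1)\<^sup>2 + c2 * p $ 1 - lam * c3 * p $ 2 + c4)"
    using assms by (simp_all add: fun_eq_iff)
  have f: "smooth f1" "smooth f2" "smooth f3"
    unfolding f_eq by (intro smooth_intros)+
  define V where "V = (\<lambda>p. f1 p *\<^sub>R e1 p + f2 p *\<^sub>R e2 p + f3 p *\<^sub>R e3 p)"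
  have V: "smooth V"
    unfolding V_def by (rule smooth_heis_field[OF f])
  \<comment> \<open>The field acts on the frame as a constant infinitesimal rotation of e1 and e2
    that fixes e3. The frame formulas for the connection are compatible with this rotation, which is
    what the check of the nine pairs below confirms.\<close>
  have L: "lie_bracket V e1 = (\<lambda>p. (lam * c1) *\<^sub>R e2 p)" "lie_bracket V e2 = (\<lambda>p. (- lam * c1) *\<^sub>R e1 p)"
    "lie_bracket V e3 = (\<lambda>p. 0)"
    unfolding V_def lie_bracket_heis_field[OF f] unfolding f_eq
    by (simp_all add: dir_deriv_simps smooth_intros heis_e1_def heis_e2_def heis_e3_def
        vec_eq_iff forall_3 power2_eq_square fun_eq_iff algebra_simps)
  have Lc: "lie_bracket V (\<lambda>p. c *\<^sub>R Y p) p = c *\<^sub>R lie_bracket V Y p" if "smooth Y" for c Y p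
    by (simp add: lie_bracket_scaleR_right that V smooth_const dir_deriv_const)
  have L0: "lie_bracket V (\<lambda>p. 0) p = 0" for p
    using Lc[OF V, of 0] by simp
  have "lie_deriv_connection D V U W p = 0" if "U \<in> {e1, e2, e3}" "W \<in> {e1, e2, e3}" for U W p
    using that
    by (auto simp: lie_deriv_connection_def heis_connection_simps L Lc L0
        simp del: scaleR_minus_left simp flip: scaleR_minus_left scaleR_left.add scaleR_left.diff)
  then have "lie_deriv_connection D V Y Z p = 0" if "smooth Y" "smooth Z" for Y Z p
    using that by (rule lie_deriv_connection_zero_if_frame[OF V, rotated 2])
  with V show ?thesis
    by (auto simp: affine_vector_field_iff V_def)
qed

end

theorem theorem3p7:
  fixes lam :: real and f1 f2 f3 :: "real ^ 3 \<Rightarrow> real"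
  assumes "lam \<noteq> 0"
    and "smooth f1" and "smooth f2" and "smooth f3"
  shows "affine_vector_field (heis_g2 lam)
           (\<lambda>p. f1 p *\<^sub>R heis_e1 p + f2 p *\<^sub>R heis_e2 lam p + f3 p *\<^sub>R heis_e3 p)
         \<longleftrightarrow>
         (\<exists>c1 c2 c3 c4 :: real. \<forall>x y z :: real.
            f1 (vector [x, y, z]) = c1 * x + c2 \<and>
            f2 (vector [x, y, z]) = - lam * c1 * y + c3 \<and>
            f3 (vector [x, y, z]) =
              lam\<^sup>2 * c1 / 2 * y\<^sup>2 + c1 / 2 * x\<^sup>2 + c2 * x - lam * c3 * y + c4)"
    (is "?affine \<longleftrightarrow> ?formula")
proof
  assume ?affine
  from heis_affine_field_integrate[OF assms this] show ?formula
    by (metis vector_3)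
next
  assume ?formula
  then obtain c1 c2 c3 c4 where c: "\<And>x y z.
      f1 (vector [x, y, z]) = c1 * x + c2 \<and>
      f2 (vector [x, y, z]) = - lam * c1 * y + c3 \<and>
      f3 (vector [x, y, z]) = lam\<^sup>2 * c1 / 2 * y\<^sup>2 + c1 / 2 * x\<^sup>2 + c2 * x - lam * c3 * y + c4"
    by blast
  have "vector [p $ 1, p $ 2, p $ 3] = p" for p :: "real ^ 3"
    by (simp add: vec_eq_iff forall_3)
  then have "f1 p = c1 * p $ 1 + c2" "f2 p = - lam * c1 * p $ 2 + c3"
    "f3 p = lam\<^sup>2 * c1 / 2 * (p $ 2)\<^sup>2 + c1 / 2 * (p $ 1)\<^sup>2 + c2 * p $ 1 - lam * c3 * p $ 2 + c4" for p
    using c[of "p $ 1" "p $ 2" "p $ 3"] by simp_all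
  then show ?affine
    by (rule heis_field_affine[OF assms(1)])
qed

end
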